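(* (Homotopy invariance of the $\mu$-invariant.) Let $F\colon[a,b]\times[0,1]\to\mathfrak S_1(\mathbb T)$ be continuous with $F(a,t)=\mathbf 1$ for all $t\in[0,1]$ and $F(b,t)=F_1$ for all $t\in[0,1]$, where $F_1\in\mathfrak S_1(\mathbb T)$ is fixed. Then the paths $F(\cdot,0)$ and $F(\cdot,1)$ have the same $\mu$-invariant: $\mu(\theta;F(\cdot,0))=\mu(\theta;F(\cdot,1))$ for all $\theta\in(0,2\pi)$.
   Context: Rigged sets: each point has a multiplicity in $\{0,1,\dots,\infty\}$; an enumeration lists each point according to its multiplicity. For a metric space $X$ with base point $x_0$, $\mathfrak S_1(X)$ is the set of countable rigged subsets of $X$ with $x_0$ of infinite multiplicity, no accumulation point other than $x_0$, and $d(S,\mathbf x_0)<\infty$, where $d(S,T)=\inf\sum_j\mathrm{dist}(s_j,t_j)$ over enumerations and $\mathbf x_0$ is $x_0$ with infinite multiplicity; $\mathfrak S_1(\mathbb T)$ has base point $1$ (arc-length metric), $\mathfrak S_1(\mathbb R)$ base point $0$; $\mathbf 1$ denotes $1$ with infinite multiplicity. $p\colon\mathfrak S_1(\mathbb R)\to\mathfrak S_1(\mathbb T)$ is induced by $\theta\mapsto e^{i\theta}$. For $\theta\in(0,2\pi)$ and $\theta_1<\theta_2$, $[\theta;\theta_1,\theta_2]=\frac12\big(\#\{k\in\mathbb Z:\theta_1<\theta+2\pi k<\theta_2\}+\#\{k\in\mathbb Z:\theta_1\le\theta+2\pi k\le\theta_2\}\big)$, $[\theta;\theta_1,\theta_2]=-[\theta;\theta_2,\theta_1]$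 if $\theta_2<\theta_1$, and $0$ if equal. The $\mu$-invariant of a continuous path $S\colon[a,b]\to\mathfrak S_1(\mathbb T)$ is $\mu(\theta;S)=\sum_j[\theta;\theta_j(a),\theta_j(b)]$, where $\tilde S\colon[a,b]\to\mathfrak S_1(\mathbb R)$ is a continuous lift ($p\circ\tilde S=S$) and $\theta_1,\theta_2,\dots$ are continuous real functions such that for each $r$, $\{\theta_j(r)\}$ (together with $0$ of infinite multiplicity) equals $\tilde S(r)$; it does not depend on these choices. *)

theory Defs
  imports "HOL-Analysis.Analysis"
begin

text \<open>Rigged sets: a rigged subset of a space is its multiplicity function into enat
  (0 = not in the set, \<infinity> = infinite multiplicity).\<close>

type_synonym 'a rigged = "'a \<Rightarrow> enat"

definition ecount :: "'b set \<Rightarrow> enat" where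
  "ecount A = (if finite A then enat (card A) else \<infinity>)"

text \<open>An enumeration of S lists every point according to its multiplicity
  (for the sets in S_1 considered here, enumerations are infinite sequences).\<close>
definition is_enum :: "(nat \<Rightarrow> 'a) \<Rightarrow> 'a rigged \<Rightarrow> bool" where
  "is_enum s S \<longleftrightarrow> (\<forall>x. ecount {j. s j = x} = S x)"

definition rdist :: "('a \<Rightarrow> 'a \<Rightarrow> real) \<Rightarrow> 'a rigged \<Rightarrow> 'a rigged \<Rightarrow> ennreal" where
  "rdist \<delta> S T = (INF st \<in> {(s, t). is_enum s S \<and> is_enum t T}.
                     (\<Sum>j. ennreal (\<delta> (fst st j) (snd st j))))"

definition rpoint :: "'a \<Rightarrow> 'a rigged" where
  "rpoint x0 = (\<lambda>x. if x = x0 then \<infinity> else 0)"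

definition rsupp :: "'a rigged \<Rightarrow> 'a set" where
  "rsupp S = {x. S x \<noteq> 0}"

definition S1 :: "('a \<Rightarrow> 'a \<Rightarrow> real) \<Rightarrow> 'a set \<Rightarrow> 'a \<Rightarrow> 'a rigged \<Rightarrow> bool" where
  "S1 \<delta> X x0 S \<longleftrightarrow>
     rsupp S \<subseteq> X \<and> countable (rsupp S) \<and> S x0 = \<infinity> \<and>
     (\<forall>y\<in>X. y \<noteq> x0 \<longrightarrow>
        \<not> (\<forall>e>0. \<exists>x\<in>rsupp S. x \<noteq> y \<and> \<delta> x y < e)) \<and>
     rdist \<delta> S (rpoint x0) < \<infinity>"

definition arcdist :: "complex \<Rightarrow> complex \<Rightarrow> real" where
  "arcdist z w = \<bar>Arg (z * cnj w)\<bar>"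

definition S1T :: "complex rigged \<Rightarrow> bool" where
  "S1T S \<longleftrightarrow> S1 arcdist (sphere 0 1) 1 S"

definition S1R :: "real rigged \<Rightarrow> bool" where
  "S1R S \<longleftrightarrow> S1 dist UNIV 0 S"

text \<open>The map p : S_1(R) \<rightarrow> S_1(T) induced by theta \<mapsto> exp(i theta)
  (push-forward of multiplicities).\<close>
definition pmap :: "real rigged \<Rightarrow> complex rigged" where
  "pmap S = (\<lambda>z. SUP F \<in> {F. finite F \<and> F \<subseteq> {\<theta>. cis \<theta> = z}}. sum S F)"

definition rcont :: "('a \<Rightarrow> 'a \<Rightarrow> real) \<Rightarrow> 'b::metric_space set \<Rightarrow> ('b \<Rightarrow> 'a rigged) \<Rightarrow> bool" where
  "rcont \<delta> D F \<longleftrightarrow>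
     (\<forall>p\<in>D. \<forall>e>0. \<exists>d>0. \<forall>q\<in>D. dist q p < d \<longrightarrow> rdist \<delta> (F q) (F p) < ennreal e)"

definition bracket :: "real \<Rightarrow> real \<Rightarrow> real \<Rightarrow> real" where
  "bracket \<theta> \<theta>1 \<theta>2 =
    (if \<theta>1 < \<theta>2 then
       (real (card {k::int. \<theta>1 < \<theta> + 2*pi*k \<and> \<theta> + 2*pi*k < \<theta>2})
        + real (card {k::int. \<theta>1 \<le> \<theta> + 2*pi*k \<and> \<theta> + 2*pi*k \<le> \<theta>2})) / 2
     else if \<theta>2 < \<theta>1 then
       - ((real (card {k::int. \<theta>2 < \<theta> + 2*pi*k \<and> \<theta> + 2*pi*k < \<theta>1})
        + real (card {k::int. \<theta>2 \<le> \<theta> + 2*pi*k \<and> \<theta> + 2*pi*k \<le> \<theta>1})) / 2)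
     else 0)"

definition is_lift :: "real \<Rightarrow> real \<Rightarrow> (real \<Rightarrow> complex rigged) \<Rightarrow> (real \<Rightarrow> real rigged) \<Rightarrow> bool" where
  "is_lift a b S L \<longleftrightarrow>
     (\<forall>r\<in>{a..b}. S1R (L r)) \<and> rcont dist {a..b} L \<and> (\<forall>r\<in>{a..b}. pmap (L r) = S r)"

text \<open>th_1, th_2, ... are continuous real functions on [a,b] whose values at r, together
  with 0 of infinite multiplicity, form L(r).\<close>
definition is_branches :: "real \<Rightarrow> real \<Rightarrow> (real \<Rightarrow> real rigged) \<Rightarrow> (nat \<Rightarrow> real \<Rightarrow> real) \<Rightarrow> bool" where
  "is_branches a b L th \<longleftrightarrow>
     (\<forall>j. continuous_on {a..b} (th j)) \<and>
     (\<forall>r\<in>{a..b}. \<forall>x. x \<noteq> 0 \<longrightarrow> ecount {j. th j r = x} = L r x)"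

text \<open>The mu-invariant of a path S : [a,b] \<rightarrow> S_1(T) (independent of the choices).\<close>
definition mu :: "real \<Rightarrow> real \<Rightarrow> real \<Rightarrow> (real \<Rightarrow> complex rigged) \<Rightarrow> real" where
  "mu \<theta> a b S = (SOME v. \<exists>L th. is_lift a b S L \<and> is_branches a b L th \<and>
                      v = (\<Sum>j. bracket \<theta> (th j a) (th j b)))"

end

theory Submission
  imports Defs
begin

text \<open>The bracket equals \<open>g y - g x\<close> for a step function \<open>g\<close> with \<open>g 0 = 0\<close> such that
  \<open>g x - x / (2\<pi>)\<close> depends on \<open>cis x\<close> only. Summing over the branches, the \<open>\<mu>\<close>-invariant is therefore
  \<open>1 / (2\<pi>)\<close> times the increment of the sum of all branches, plus a term determined by the two
  end points of the path. The sum of the branches is a continuous argument of the product of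
  all points of \<open>S(r)\<close>. That product depends continuously on \<open>(r, t)\<close>, so over the rectangle it has
  a continuous logarithm, and as the vertical edges are constant, the increment of the argument
  does not depend on \<open>t\<close>.

  Branches exist for every path. Near each parameter value the points avoid some arc of the circle;
  cutting the circle open there, the sorted positive and the sorted negative angles are continuous
  in the l1-norm. Finitely many such local lifts are glued after a permutation and shifts by
  multiples of \<open>2\<pi>\<close>.\<close>

section \<open>Multiplicities\<close>

text \<open>The homotopy itself is never lifted. Over the rectangle only the unit number
  \<open>rprod (F p)\<close> is followed, and each horizontal path is lifted on its own. The hard
  part is a continuous labelling of the points. A small distance between two rigged sets is
  witnessed by a pair of enumerations that depends on both sets, so the labellings suggested at
  neighbouring parameters need not fit together. Sorting gives a labelling that depends on the
  rigged set alone and does not increase l1-distances. Sorting needs real angles, and no single cut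
  serves a whole path, since points may travel around the circle. But only finitely many points of a
  rigged set are far from 1, so at each parameter some cut at an angle between pi - 1 and pi avoids
  all of them, with a margin that survives small changes of the parameter.\<close>

lemma ecount_eq_iff_bij:
  fixes A :: "'a :: countable set" and B :: "'b :: countable set"
  assumes "ecount A = ecount B"
  shows "\<exists>f. bij_betw f A B"
proof (cases "finite A")
  case True
  with assms have "finite B" "card A = card B"
    by (auto simp: ecount_def split: if_splits)
  with True show ?thesis
    by (simp add: bij_betw_iff_card)
next
  case False
  with assms have "infinite B"
    by (auto simp: ecount_def split: if_splits)
  with False show ?thesis
    by (meson bij_betw_trans bij_betw_from_nat_into countableI_type countableE_infinite)
qed

lemma ecount_bij: "bij_betw f A B \<Longrightarrow> ecount A = ecount B"
  by (auto simp: ecount_def bij_betw_finite bij_betw_same_card)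

lemma ecount_Un:
  assumes "A \<inter> B = {}"
  shows "ecount (A \<union> B) = ecount A + ecount B"
  using assms by (auto simp: ecount_def card_Un_disjoint)

lemma ecount_mono: "A \<subseteq> B \<Longrightarrow> ecount A \<le> ecount B"
  by (auto simp: ecount_def card_mono dest: finite_subset)

lemma ecount_eq_0_iff: "ecount A = 0 \<longleftrightarrow> A = {}"
  by (auto simp: ecount_def zero_enat_def)

lemma sum_ecount_vimage:
  assumes "finite F"
  shows "(\<Sum>x\<in>F. ecount {j. f j = x}) = ecount {j. f j \<in> F}"
  using assms
proof (induction F)
  case empty
  then show ?case by (simp add: ecount_def zero_enat_def)
next
  case (insert y F)
  have "{j. f j \<in> insert y F} = {j. f j = y} \<union> {j. f j \<in> F}" by auto
  moreover have "{j. f j = y} \<inter> {j. f j \<in> F} = {}" using insert by auto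
  ultimately show ?case using insert by (simp add: ecount_Un)
qed

lemma SUP_sum_ecount:
  "(SUP F \<in> {F. finite F \<and> F \<subseteq> B}. \<Sum>x\<in>F. ecount {j. f j = x}) = ecount {j. f j \<in> B}"
proof (rule antisym)
  show "(SUP F \<in> {F. finite F \<and> F \<subseteq> B}. \<Sum>x\<in>F. ecount {j. f j = x}) \<le> ecount {j. f j \<in> B}"
    by (rule SUP_least) (auto simp: sum_ecount_vimage intro!: ecount_mono)
next
  let ?S = "SUP F \<in> {F. finite F \<and> F \<subseteq> B}. \<Sum>x\<in>F. ecount {j. f j = x}"
  have lower: "enat (card J) \<le> ?S" if J: "finite J" "J \<subseteq> {j. f j \<in> B}" for J
  proof -
    have "enat (card J) = ecount J" using J by (simp add: ecount_def)
    also have "\<dots> \<le> ecount {j. f j \<in> f ` J}" by (rule ecount_mono) auto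
    also have "\<dots> = (\<Sum>x\<in>f ` J. ecount {j. f j = x})"
      using J by (simp add: sum_ecount_vimage)
    also have "\<dots> \<le> ?S" using J by (intro SUP_upper) auto
    finally show ?thesis .
  qed
  show "ecount {j. f j \<in> B} \<le> ?S"
  proof (cases "finite {j. f j \<in> B}")
    case True
    then show ?thesis using lower[OF True] by (simp add: ecount_def)
  next
    case False
    have "enat n \<le> ?S" for n
    proof -
      obtain J where "finite J" "card J = n" "J \<subseteq> {j. f j \<in> B}"
        using infinite_arbitrarily_large[OF False, of n] by blast
      then show ?thesis using lower by blast
    qed
    then have "?S = \<infinity>" by (cases ?S) (simp_all, metis Suc_n_not_le_n)
    then show ?thesis by simp
  qed
qed

text \<open>The base point is left out because the branches of a lift are free to list it any number
  of times.\<close>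

definition same_mult_off :: "'a \<Rightarrow> (nat \<Rightarrow> 'a) \<Rightarrow> (nat \<Rightarrow> 'a) \<Rightarrow> bool" where
  "same_mult_off x0 u v \<longleftrightarrow> (\<forall>x. x \<noteq> x0 \<longrightarrow> ecount {j. u j = x} = ecount {j. v j = x})"

lemma same_mult_off_sym: "same_mult_off x0 u v \<Longrightarrow> same_mult_off x0 v u"
  by (simp add: same_mult_off_def)

lemma is_enum_same_mult_off: "is_enum u S \<Longrightarrow> is_enum v S \<Longrightarrow> same_mult_off x0 u v"
  by (simp add: same_mult_off_def is_enum_def)

text \<open>Bijections chosen separately on the fibres combine, since every index lies in exactly
  one fibre. Restricting to \<open>X\<close> allows the base point to be left out.\<close>

lemma bij_betw_of_fibres:
  fixes u :: "'i :: countable \<Rightarrow> 'a" and v :: "'j :: countable \<Rightarrow> 'a"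
  assumes "\<And>x. x \<in> X \<Longrightarrow> ecount {j. u j = x} = ecount {j. v j = x}"
  obtains \<pi> where "bij_betw \<pi> {j. u j \<in> X} {j. v j \<in> X}" "\<And>j. u j \<in> X \<Longrightarrow> v (\<pi> j) = u j"
proof -
  have "\<exists>f. \<forall>x\<in>X. bij_betw (f x) {j. u j = x} {j. v j = x}"
    using ecount_eq_iff_bij[OF assms] by metis
  then obtain f where f: "\<And>x. x \<in> X \<Longrightarrow> bij_betw (f x) {j. u j = x} {j. v j = x}" by blast
  define \<pi> where "\<pi> = (\<lambda>j. f (u j) j)"
  have eq: "v (\<pi> j) = u j" if "u j \<in> X" for j
    using bij_betwE[OF f[OF that]] by (simp add: \<pi>_def)
  have "bij_betw \<pi> {j. u j \<in> X} {j. v j \<in> X}"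
    unfolding bij_betw_def
  proof
    show "inj_on \<pi> {j. u j \<in> X}"
    proof (rule inj_onI)
      fix i j assume a: "i \<in> {j. u j \<in> X}" "j \<in> {j. u j \<in> X}" "\<pi> i = \<pi> j"
      then have "u i = u j" using eq by (metis mem_Collect_eq)
      then show "i = j"
        using a bij_betw_imp_inj_on[OF f, of "u j"] by (auto simp: \<pi>_def inj_on_def)
    qed
    show "\<pi> ` {j. u j \<in> X} = {j. v j \<in> X}"
    proof (intro equalityI subsetI)
      fix i assume i: "i \<in> {j. v j \<in> X}"
      then obtain j where "u j = v i" "f (v i) j = i"
        using bij_betw_imp_surj_on[OF f, of "v i"] by (force simp: image_def)
      then show "i \<in> \<pi> ` {j. u j \<in> X}" using i by (auto simp: \<pi>_def image_iff intro!: exI[of _ j])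
    qed (auto simp: eq)
  qed
  with eq show thesis using that by blast
qed

lemma is_enum_bij:
  assumes "is_enum u S" "is_enum v S"
  obtains \<pi> where "bij \<pi>" "\<And>j. v (\<pi> j) = u j"
  using bij_betw_of_fibres[of UNIV u v] assms by (auto simp: is_enum_def)

lemma same_mult_off_bij:
  assumes "bij \<pi>"
  shows "same_mult_off x0 (\<lambda>j. u (\<pi> j)) u"
  unfolding same_mult_off_def
proof (intro allI impI)
  fix x
  have "bij_betw \<pi> {j. u (\<pi> j) = x} {j. u j = x}"
    using assms by (auto simp: bij_betw_def bij_def inj_on_def image_iff)
  then show "ecount {j. u (\<pi> j) = x} = ecount {j. u j = x}" by (rule ecount_bij)
qed

text \<open>A fibre of \<open>f\<close> after \<open>u\<close> over a point other than
  \<open>f x0\<close> contains no index with value \<open>x0\<close>, so the matching of indices off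
  \<open>x0\<close> restricts to it. The case of interest is \<open>cis\<close>, which takes 0 to
  1.\<close>

lemma same_mult_off_comp:
  assumes "same_mult_off x0 u v"
  shows "same_mult_off (f x0) (\<lambda>j. f (u j)) (\<lambda>j. f (v j))"
proof -
  obtain \<pi> where \<pi>: "bij_betw \<pi> {j. u j \<in> - {x0}} {j. v j \<in> - {x0}}"
      "\<And>j. u j \<in> - {x0} \<Longrightarrow> v (\<pi> j) = u j"
    using bij_betw_of_fibres[of "- {x0}" u v] assms by (auto simp: same_mult_off_def)
  show ?thesis
    unfolding same_mult_off_def
  proof (intro allI impI)
    fix y assume y: "y \<noteq> f x0"
    have "bij_betw \<pi> {j. f (u j) = y} {j. f (v j) = y}"
    proof (rule bij_betw_subset[OF \<pi>(1)])
      show "{j. f (u j) = y} \<subseteq> {j. u j \<in> - {x0}}" using y by auto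
      show "\<pi> ` {j. f (u j) = y} = {j. f (v j) = y}"
      proof (intro equalityI subsetI)
        fix i assume "i \<in> \<pi> ` {j. f (u j) = y}"
        then show "i \<in> {j. f (v j) = y}" using y \<pi>(2) by fastforce
      next
        fix i assume i: "i \<in> {j. f (v j) = y}"
        then have "i \<in> \<pi> ` {j. u j \<in> - {x0}}" using y bij_betw_imp_surj_on[OF \<pi>(1)] by auto
        then show "i \<in> \<pi> ` {j. f (u j) = y}" using \<pi>(2) i by (auto simp: image_iff)
      qed
    qed
    then show "ecount {j. f (u j) = y} = ecount {j. f (v j) = y}" by (rule ecount_bij)
  qed
qed

text \<open>Absolute convergence permits reordering, and \<open>f x0 = 0\<close> silences the base
  point, whose multiplicities may differ. The detour through \<open>has_sum\<close> allows a
  bijection between subsets of the indices.\<close>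

lemma same_mult_off_suminf:
  fixes f :: "'a \<Rightarrow> real"
  assumes uv: "same_mult_off x0 u v" and f0: "f x0 = 0" and summ: "summable (\<lambda>j. \<bar>f (u j)\<bar>)"
  shows "summable (\<lambda>j. \<bar>f (v j)\<bar>)" and "(\<Sum>j. f (v j)) = (\<Sum>j. f (u j))"
proof -
  obtain \<pi> where \<pi>: "bij_betw \<pi> {j. u j \<in> - {x0}} {j. v j \<in> - {x0}}"
      "\<And>j. u j \<in> - {x0} \<Longrightarrow> v (\<pi> j) = u j"
    using bij_betw_of_fibres[of "- {x0}" u v] uv by (auto simp: same_mult_off_def)
  have transfer: "((\<lambda>j. h (v j)) has_sum c) UNIV"
    if h: "h x0 = 0" "((\<lambda>j. h (u j)) has_sum c) UNIV" for h :: "'a \<Rightarrow> real" and c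
  proof -
    have "((\<lambda>j. h (u j)) has_sum c) {j. u j \<in> - {x0}}"
      using h by (subst has_sum_cong_neutral[where T = UNIV and g = "\<lambda>j. h (u j)"]) auto
    then have "((\<lambda>j. h (v (\<pi> j))) has_sum c) {j. u j \<in> - {x0}}"
      using \<pi>(2) by (subst has_sum_cong[where g = "\<lambda>j. h (u j)"]) auto
    then have "((\<lambda>j. h (v j)) has_sum c) {j. v j \<in> - {x0}}"
      by (subst (asm) has_sum_reindex_bij_betw[OF \<pi>(1)])
    then show ?thesis
      using h by (subst has_sum_cong_neutral[where T = "{j. v j \<in> - {x0}}" and g = "\<lambda>j. h (v j)"]) auto
  qed
  have "((\<lambda>j. \<bar>f (u j)\<bar>) has_sum (\<Sum>j. \<bar>f (u j)\<bar>)) UNIV"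
    using summ by (intro norm_summable_imp_has_sum) (auto intro: summable_sums)
  from transfer[OF _ this] have "(\<lambda>j. \<bar>f (v j)\<bar>) sums (\<Sum>j. \<bar>f (u j)\<bar>)"
    using f0 by (intro has_sum_imp_sums) auto
  then show "summable (\<lambda>j. \<bar>f (v j)\<bar>)" by (rule sums_summable)
  have "((\<lambda>j. f (u j)) has_sum (\<Sum>j. f (u j))) UNIV"
    using summ by (intro norm_summable_imp_has_sum) (auto intro: summable_sums summable_rabs_cancel)
  from transfer[OF f0 this] show "(\<Sum>j. f (v j)) = (\<Sum>j. f (u j))"
    by (intro sums_unique[symmetric] has_sum_imp_sums)
qed

section \<open>Sorting null sequences\<close>

text \<open>Counted from 0. The restriction to \<open>0 < x\<close> avoids the infinite sets \<open>{j. x < u j}\<close>,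
  whose \<open>card\<close> would be 0.\<close>

definition kth_largest :: "(nat \<Rightarrow> real) \<Rightarrow> nat \<Rightarrow> real" where
  "kth_largest u k = Inf {x. 0 < x \<and> card {j. x < u j} \<le> k}"

lemma finite_greater_of_null:
  fixes u :: "nat \<Rightarrow> real"
  assumes "u \<longlonglongrightarrow> 0" "0 < x"
  shows "finite {j. x < \<bar>u j\<bar>}"
proof -
  have "\<forall>\<^sub>F j in sequentially. \<bar>u j\<bar> < x"
    using assms tendstoD[OF assms] by (simp add: dist_real_def)
  then have "\<forall>\<^sub>F j in cofinite. \<not> x < \<bar>u j\<bar>"
    unfolding cofinite_eq_sequentially by eventually_elim simp
  then show ?thesis by (simp add: eventually_cofinite)
qed

lemma finite_greater_of_null_nonneg:
  fixes u :: "nat \<Rightarrow> real"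
  assumes "u \<longlonglongrightarrow> 0" "0 < x"
  shows "finite {j. x < u j}"
  by (rule finite_subset[OF _ finite_greater_of_null[OF assms]]) auto

lemma kth_largest_le:
  assumes "0 < x" "card {j. x < u j} \<le> k"
  shows "kth_largest u k \<le> x"
  unfolding kth_largest_def by (rule cInf_lower) (use assms in \<open>auto intro: bdd_belowI[of _ 0]\<close>)

lemma kth_largest_ge:
  fixes u :: "nat \<Rightarrow> real"
  assumes u: "u \<longlonglongrightarrow> 0" and m: "\<And>x. 0 < x \<Longrightarrow> x < m \<Longrightarrow> k < card {j. x < u j}"
  shows "m \<le> kth_largest u k"
  unfolding kth_largest_def
proof (rule cInf_greatest)
  \<comment> \<open>\<open>cInf_greatest\<close> needs a nonempty set; any positive bound of the
    sequence belongs to it.\<close>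
  have "Bseq u" using u by (intro convergent_imp_Bseq convergentI)
  then obtain K where "\<And>j. \<bar>u j\<bar> \<le> K" "K > 0" by (auto simp: Bseq_def)
  then have "\<And>j. \<not> K < u j" by (meson abs_le_D1 not_less)
  with \<open>K > 0\<close> show "{x. 0 < x \<and> card {j. x < u j} \<le> k} \<noteq> {}" by (auto intro!: exI[of _ K])
next
  fix x assume "x \<in> {x. 0 < x \<and> card {j. x < u j} \<le> k}"
  then show "m \<le> x" using m[of x] by force
qed

lemma kth_largest_nonneg:
  fixes u :: "nat \<Rightarrow> real"
  shows "u \<longlonglongrightarrow> 0 \<Longrightarrow> 0 \<le> kth_largest u k"
  by (rule kth_largest_ge) auto

lemma less_kth_largest_iff:
  fixes u :: "nat \<Rightarrow> real"
  assumes u: "u \<longlonglongrightarrow> 0" and x: "0 < x"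
  shows "x < kth_largest u k \<longleftrightarrow> k < card {j. x < u j}"
proof
  assume k: "k < card {j. x < u j}"
  \<comment> \<open>Only finitely many terms exceed \<open>x\<close>, so the smallest of them leaves
    a gap above \<open>x\<close>. The gap yields a strict inequality for an infimum.\<close>
  define m where "m = Min (u ` {j. x < u j})"
  have fin: "finite {j. x < u j}" using finite_greater_of_null_nonneg[OF u x] .
  have ne: "{j. x < u j} \<noteq> {}" using k by (metis card.empty not_less_zero)
  have "x < m" using fin ne by (simp add: m_def)
  also have "m \<le> kth_largest u k"
  proof (rule kth_largest_ge[OF u])
    fix y :: real assume y: "0 < y" "y < m"
    have "m \<le> u j" if "x < u j" for j
      unfolding m_def using fin that by (intro Min_le) auto
    then have "{j. x < u j} \<subseteq> {j. y < u j}" using y by force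
    then have "card {j. x < u j} \<le> card {j. y < u j}"
      by (intro card_mono finite_greater_of_null_nonneg[OF u y(1)])
    with k show "k < card {j. y < u j}" by linarith
  qed
  finally show "x < kth_largest u k" .
next
  assume "x < kth_largest u k"
  then show "k < card {j. x < u j}" using kth_largest_le[OF x, of u k] by linarith
qed

lemma le_kth_largest_iff:
  fixes u :: "nat \<Rightarrow> real"
  assumes u: "u \<longlonglongrightarrow> 0" and x: "0 < x"
  shows "x \<le> kth_largest u k \<longleftrightarrow> k < card {j. x \<le> u j}"
proof -
  have fin: "finite {j. x/2 < u j}" using finite_greater_of_null_nonneg[OF u, of "x/2"] x by simp
  \<comment> \<open>No term lies strictly between \<open>m\<close> and \<open>x\<close>, because
    only finitely many exceed \<open>x/2\<close>. Inserting \<open>x/2\<close> keeps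
    \<open>m\<close> positive and the maximum defined.\<close>
  define m where "m = Max (insert (x/2) (u ` {j. x/2 < u j \<and> u j < x}))"
  have fin': "finite (insert (x/2) (u ` {j. x/2 < u j \<and> u j < x}))"
    by (rule finite.insertI, rule finite_imageI, rule finite_subset[OF _ fin]) auto
  have m: "x/2 \<le> m" "m < x"
    unfolding m_def using Max_ge[OF fin', of "x/2"] Max_less_iff[OF fin', of x] x by auto
  have eq: "{j. y < u j} = {j. x \<le> u j}" if y: "m \<le> y" "y < x" for y
  proof (intro Collect_cong iffI)
    fix j assume "y < u j"
    then have j: "m < u j" using y by simp
    show "x \<le> u j"
    proof (rule ccontr)
      assume "\<not> x \<le> u j"
      then have "u j \<le> m" unfolding m_def using j m by (intro Max_ge[OF fin']) auto
      with j show False by simp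
    qed
  qed (use y in simp)
  show ?thesis
  proof
    assume "x \<le> kth_largest u k"
    then have "m < kth_largest u k" using m by simp
    then show "k < card {j. x \<le> u j}" using less_kth_largest_iff[OF u, of m k] eq[of m] m x by simp
  next
    assume k: "k < card {j. x \<le> u j}"
    show "x \<le> kth_largest u k"
    proof (rule dense_le_bounded[OF m(2)])
      fix y assume "m < y" "y < x"
      then show "y \<le> kth_largest u k" using less_kth_largest_iff[OF u, of y k] eq[of y] k m x by simp
    qed
  qed
qed

text \<open>For \<open>x > 0\<close> the positions holding \<open>x\<close> run from the number of
  terms above \<open>x\<close> to the number of terms at least \<open>x\<close>, and the difference
  counts the terms equal to \<open>x\<close>. The value 0 must be left out: if infinitely many terms
  are positive, the sorted sequence never reaches 0.\<close>

lemma same_mult_off_kth_largest: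
  fixes u :: "nat \<Rightarrow> real"
  assumes u: "u \<longlonglongrightarrow> 0" and nonneg: "\<And>j. 0 \<le> u j"
  shows "same_mult_off 0 (kth_largest u) u"
  unfolding same_mult_off_def
proof (intro allI impI)
  fix x :: real assume "x \<noteq> 0"
  show "ecount {k. kth_largest u k = x} = ecount {j. u j = x}"
  proof (cases "0 < x")
    case False
    with \<open>x \<noteq> 0\<close> have "x < 0" by simp
    then have "{k. kth_largest u k = x} = {}" "{j. u j = x} = {}"
      using kth_largest_nonneg[OF u] nonneg by (smt (verit) empty_Collect_eq)+
    then show ?thesis by simp
  next
    case x: True
    have "{j. x \<le> u j} \<subseteq> {j. x / 2 < u j}" using x by auto
    moreover have "finite {j. x / 2 < u j}" using finite_greater_of_null_nonneg[OF u, of "x/2"] x by simp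
    ultimately have fin: "finite {j. x < u j}" "finite {j. x \<le> u j}"
      using finite_greater_of_null_nonneg[OF u x] by (auto intro: finite_subset)
    have "kth_largest u k = x \<longleftrightarrow> k \<in> {card {j. x < u j}..<card {j. x \<le> u j}}" for k
      using less_kth_largest_iff[OF u x, of k] le_kth_largest_iff[OF u x, of k]
      unfolding atLeastLessThan_iff by linarith
    then have "{k. kth_largest u k = x} = {card {j. x < u j}..<card {j. x \<le> u j}}"
      by blast
    then have "ecount {k. kth_largest u k = x} = enat (card {j. x \<le> u j} - card {j. x < u j})"
      by (simp add: ecount_def)
    also have "card {j. x \<le> u j} - card {j. x < u j} = card ({j. x \<le> u j} - {j. x < u j})"
      using fin by (intro card_Diff_subset[symmetric]) auto
    also have "{j. x \<le> u j} - {j. x < u j} = {j. u j = x}" by auto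
    also have "enat (card {j. u j = x}) = ecount {j. u j = x}"
      using finite_subset[OF _ fin(2), of "{j. u j = x}"] by (auto simp: ecount_def)
    finally show ?thesis .
  qed
qed

lemma kth_largest_mono:
  fixes u v :: "nat \<Rightarrow> real"
  assumes u: "u \<longlonglongrightarrow> 0" and v: "v \<longlonglongrightarrow> 0" and le: "\<And>j. u j \<le> v j"
  shows "kth_largest u k \<le> kth_largest v k"
proof (rule ccontr)
  assume "\<not> kth_largest u k \<le> kth_largest v k"
  then obtain x where x: "kth_largest v k < x" "x < kth_largest u k" using dense by (metis not_less)
  then have pos: "0 < x" using kth_largest_nonneg[OF v, of k] by linarith
  have "k < card {j. x < u j}" using x less_kth_largest_iff[OF u pos] by blast
  also have "\<dots> \<le> card {j. x < v j}"
    using le by (intro card_mono finite_greater_of_null_nonneg[OF v pos]) (auto intro: less_le_trans)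
  finally show False using x less_kth_largest_iff[OF v pos, of k] by linarith
qed

lemma kth_largest_cong_bij:
  assumes "bij \<pi>"
  shows "kth_largest (\<lambda>j. u (\<pi> j)) = kth_largest u"
proof -
  have "card {j. x < u (\<pi> j)} = card {j. x < u j}" for x
  proof (rule bij_betw_same_card)
    have "\<pi> ` {j. x < u (\<pi> j)} = {j. x < u j}"
      using bij_is_surj[OF assms] by (auto simp: image_iff)
    then show "bij_betw \<pi> {j. x < u (\<pi> j)} {j. x < u j}"
      by (intro bij_betw_subset[OF assms]) auto
  qed
  then show ?thesis by (simp add: kth_largest_def fun_eq_iff)
qed

text \<open>Comparing both sequences with their pointwise maximum turns the contraction estimate into
  an identity between sums, which sorting preserves.\<close>

lemma kth_largest_l1_contraction:
  fixes u v :: "nat \<Rightarrow> real"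
  assumes u: "summable u" "\<And>j. 0 \<le> u j" and v: "summable v" "\<And>j. 0 \<le> v j"
  shows "summable (\<lambda>k. \<bar>kth_largest u k - kth_largest v k\<bar>)"
    and "(\<Sum>k. \<bar>kth_largest u k - kth_largest v k\<bar>) \<le> (\<Sum>j. \<bar>u j - v j\<bar>)"
proof -
  define w where "w = (\<lambda>j. max (u j) (v j))"
  have w: "summable w" "\<And>j. 0 \<le> w j"
  proof -
    show "summable w"
      by (rule summable_comparison_test'[OF summable_add[OF u(1) v(1)], of 0])
         (use u(2) v(2) in \<open>auto simp: w_def max_def\<close>)
  qed (use u(2) in \<open>simp add: w_def le_max_iff_disj\<close>)
  have sorted: "summable (kth_largest x)" "suminf (kth_largest x) = suminf x"
    if "summable x" "\<And>j. 0 \<le> x j" for x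
  proof -
    have null: "x \<longlonglongrightarrow> 0" using that(1) by (rule summable_LIMSEQ_zero)
    have "same_mult_off 0 x (kth_largest x)"
      using same_mult_off_kth_largest[OF null] that by (simp add: same_mult_off_sym)
    from same_mult_off_suminf[OF this, of "\<lambda>y. y"]
    show "summable (kth_largest x)" "suminf (kth_largest x) = suminf x"
      using that kth_largest_nonneg[OF null] by simp_all
  qed
  \<comment> \<open>At the pointwise maximum \<open>w\<close> this is exactly
    \<open>\<bar>u k - v k\<bar>\<close>; after sorting, monotonicity only makes it an upper
    bound.\<close>
  let ?b = "\<lambda>u v w k. (w k - u k) + (w k - v k) :: real"
  have null: "u \<longlonglongrightarrow> 0" "v \<longlonglongrightarrow> 0" "w \<longlonglongrightarrow> 0"
    using u v w summable_LIMSEQ_zero by blast+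
  have le: "\<bar>kth_largest u k - kth_largest v k\<bar>
      \<le> ?b (kth_largest u) (kth_largest v) (kth_largest w) k" for k
    using kth_largest_mono[OF null(1) null(3)] kth_largest_mono[OF null(2) null(3)]
    by (smt (verit) w_def)
  have s: "summable (?b (kth_largest u) (kth_largest v) (kth_largest w))"
    using sorted u v w by (intro summable_add summable_diff) auto
  show summ: "summable (\<lambda>k. \<bar>kth_largest u k - kth_largest v k\<bar>)"
    by (rule summable_comparison_test'[OF s, of 0]) (use le in auto)
  have split: "suminf (?b x y z) = (suminf z - suminf x) + (suminf z - suminf y)"
    if "summable x" "summable y" "summable z" for x y z
    using suminf_add[OF summable_diff[OF that(3,1)] summable_diff[OF that(3,2)]]
      suminf_diff[OF that(3,1)] suminf_diff[OF that(3,2)] by simp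
  have "(\<Sum>k. \<bar>kth_largest u k - kth_largest v k\<bar>)
      \<le> suminf (?b (kth_largest u) (kth_largest v) (kth_largest w))"
    using le summ s by (intro suminf_le) auto
  also have "\<dots> = suminf (?b u v w)"
    using sorted u v w by (simp only: split)
  also have "?b u v w = (\<lambda>j. \<bar>u j - v j\<bar>)" by (auto simp: w_def max_def)
  finally show "(\<Sum>k. \<bar>kth_largest u k - kth_largest v k\<bar>) \<le> (\<Sum>j. \<bar>u j - v j\<bar>)" .
qed

section \<open>Enumerations and the product of the points\<close>

text \<open>The infimum need not be attained, but a strict bound yields one pair of enumerations
  with a convergent real series. The continuity arguments on the given path and on lifts start from
  such a pair.\<close>

lemma rdist_less_enum:
  assumes less: "rdist \<delta> S T < ennreal e" and nonneg: "\<And>x y. 0 \<le> \<delta> x y"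
  obtains s t where "is_enum s S" "is_enum t T" "summable (\<lambda>j. \<delta> (s j) (t j))"
    "(\<Sum>j. \<delta> (s j) (t j)) < e"
proof -
  obtain s t where st: "is_enum s S" "is_enum t T" "(\<Sum>j. ennreal (\<delta> (s j) (t j))) < ennreal e"
    using less unfolding rdist_def INF_less_iff by auto
  then have summ: "summable (\<lambda>j. \<delta> (s j) (t j))"
    by (intro summable_suminf_not_top nonneg) auto
  then have "ennreal (\<Sum>j. \<delta> (s j) (t j)) < ennreal e"
    using st by (subst suminf_ennreal2[symmetric]) (auto simp: nonneg)
  then have "(\<Sum>j. \<delta> (s j) (t j)) < e"
    by (simp add: ennreal_less_iff suminf_nonneg summ nonneg)
  with st summ show thesis using that by blast
qed

lemma rdist_le_suminf:
  "is_enum s S \<Longrightarrow> is_enum t T \<Longrightarrow> rdist \<delta> S T \<le> (\<Sum>j. ennreal (\<delta> (s j) (t j)))"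
  unfolding rdist_def by (rule INF_lower2[of "(s, t)"]) auto

lemma is_enum_rpoint_iff: "is_enum t (rpoint x0) \<longleftrightarrow> t = (\<lambda>_. x0)"
proof
  assume t: "is_enum t (rpoint x0)"
  have "t j = x0" for j
  proof (rule ccontr)
    assume "t j \<noteq> x0"
    then have "ecount {i. t i = t j} = 0" using t by (simp add: is_enum_def rpoint_def)
    then show False by (auto simp: ecount_eq_0_iff)
  qed
  then show "t = (\<lambda>_. x0)" by auto
qed (auto simp: is_enum_def rpoint_def ecount_def zero_enat_def)

lemma is_enum_range: "is_enum s S \<Longrightarrow> range s = rsupp S"
proof (intro equalityI subsetI)
  fix z assume s: "is_enum s S"
  have "ecount {j. s j = z} = S z" using s by (simp add: is_enum_def)
  then have iff: "z \<in> rsupp S \<longleftrightarrow> {j. s j = z} \<noteq> {}" by (simp add: rsupp_def flip: ecount_eq_0_iff)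
  show "z \<in> range s \<Longrightarrow> z \<in> rsupp S" "z \<in> rsupp S \<Longrightarrow> z \<in> range s" unfolding iff by auto
qed

lemma S1_enum:
  assumes "S1 \<delta> X x0 S" and nonneg: "\<And>x y. 0 \<le> \<delta> x y"
  obtains s where "is_enum s S" "summable (\<lambda>j. \<delta> (s j) x0)" "range s \<subseteq> X"
proof -
  from assms have "rdist \<delta> S (rpoint x0) < top" by (simp add: S1_def)
  then obtain s t where st: "is_enum s S" "is_enum t (rpoint x0)" "(\<Sum>j. ennreal (\<delta> (s j) (t j))) < top"
    unfolding rdist_def INF_less_iff by auto
  then have summ: "summable (\<lambda>j. \<delta> (s j) x0)"
    using st by (intro summable_suminf_not_top nonneg) (auto simp: is_enum_rpoint_iff)
  have "range s \<subseteq> X"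
    using assms is_enum_range[OF st(1)] by (simp add: S1_def)
  with st(1) summ that show thesis by blast
qed

lemma S1R_enum:
  assumes "S1R S"
  obtains s where "is_enum s S" "summable (\<lambda>j. \<bar>s j\<bar>)"
proof -
  obtain s where "is_enum s S" "summable (\<lambda>j. dist (s j) 0)" "range s \<subseteq> UNIV"
    using S1_enum[OF assms[unfolded S1R_def] zero_le_dist] .
  then show thesis by (intro that[of s]) auto
qed

lemma arcdist_nonneg: "0 \<le> arcdist z w"
  by (simp add: arcdist_def)

lemma arcdist_1 [simp]: "arcdist z 1 = \<bar>Arg z\<bar>"
  by (simp add: arcdist_def)

lemma S1T_enum:
  assumes "S1T S"
  obtains s where "is_enum s S" "summable (\<lambda>j. \<bar>Arg (s j)\<bar>)" "\<And>j. cmod (s j) = 1"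
proof -
  obtain s where "is_enum s S" "summable (\<lambda>j. arcdist (s j) 1)" "range s \<subseteq> sphere 0 1"
    using S1_enum[OF assms[unfolded S1T_def] arcdist_nonneg] .
  then show thesis by (intro that[of s]) (auto simp: image_subset_iff)
qed

lemma is_enum_S1T_cmod:
  assumes "S1T S" "is_enum s S"
  shows "cmod (s j) = 1"
proof -
  have "s j \<in> rsupp S" unfolding is_enum_range[OF assms(2), symmetric] by simp
  then show ?thesis using assms(1) by (auto simp: S1T_def S1_def)
qed

lemma cis_Arg_unit: "cmod z = 1 \<Longrightarrow> cis (Arg z) = z"
  using cis_Arg[of z] by (cases "z = 0") (auto simp: sgn_div_norm)

lemma cis_eq_iff: "cis x = cis y \<longleftrightarrow> (\<exists>n::int. x = y + 2*pi*n)"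
  using sin_cos_eq_iff[of x y] by (auto simp: complex_eq_iff)

text \<open>The two sums may differ by a multiple of 2*pi. The partial sums agree under
  \<open>cis\<close>, and \<open>cis\<close> is continuous.\<close>

lemma cis_suminf_cong:
  assumes "summable x" "summable y" and eq: "\<And>j. cis (x j) = cis (y j)"
  shows "cis (suminf x) = cis (suminf y)"
proof -
  have part: "cis (sum x {..<n}) = cis (sum y {..<n})" for n
    by (induction n) (simp_all add: cis_mult[symmetric] eq)
  have "(\<lambda>n. cis (sum x {..<n})) \<longlonglongrightarrow> cis (suminf x)" "(\<lambda>n. cis (sum y {..<n})) \<longlonglongrightarrow> cis (suminf y)"
    by (intro tendsto_cis summable_LIMSEQ assms)+
  then show ?thesis unfolding part by (rule LIMSEQ_unique)
qed

text \<open>The infinite product of the points of \<open>S\<close>, an analogue of the determinant.\<close>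

definition rprod :: "complex rigged \<Rightarrow> complex" where
  "rprod S = cis (\<Sum>j. Arg ((SOME s. is_enum s S) j))"

lemma S1T_enum_summable:
  assumes "S1T S" "is_enum s S"
  shows "summable (\<lambda>j. \<bar>Arg (s j)\<bar>)"
proof -
  obtain s' where "is_enum s' S" "summable (\<lambda>j. \<bar>Arg (s' j)\<bar>)" using S1T_enum[OF assms(1)] .
  then show ?thesis
    using same_mult_off_suminf(1)[OF is_enum_same_mult_off, of s' S s Arg 1] assms by simp
qed

lemma rprod_eq:
  assumes "S1T S" "is_enum s S"
  shows "rprod S = cis (\<Sum>j. Arg (s j))"
proof -
  define s' where "s' = (SOME s. is_enum s S)"
  have "is_enum s' S" unfolding s'_def using assms(2) by (rule someI[of "\<lambda>s. is_enum s S"])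
  then have "(\<Sum>j. Arg (s' j)) = (\<Sum>j. Arg (s j))"
    using assms S1T_enum_summable[OF assms]
    by (intro same_mult_off_suminf(2)[OF is_enum_same_mult_off, of s S s' Arg 1]) auto
  then show ?thesis by (simp add: rprod_def s'_def)
qed

lemma norm_cis_minus_one_le: "cmod (cis x - 1) \<le> \<bar>x\<bar>"
proof -
  have "cmod (cis x - 1) = 2 * \<bar>sin (x/2)\<bar>" unfolding cis_conv_exp by (rule dist_exp_i_1)
  also have "\<dots> \<le> \<bar>x\<bar>" using abs_sin_x_le_abs_x[of "x/2"] by simp
  finally show ?thesis .
qed

text \<open>The product is 1-Lipschitz: passing from \<open>t\<close> to \<open>s\<close> multiplies
  it by \<open>cis\<close> of the sum of the signed arcs, and that sum is bounded by the sum of the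
  arc lengths.\<close>

lemma rprod_dist:
  assumes S: "S1T S" and T: "S1T T" and less: "rdist arcdist S T < ennreal e"
  shows "dist (rprod S) (rprod T) < e"
proof -
  obtain s t where st: "is_enum s S" "is_enum t T" and summ: "summable (\<lambda>j. arcdist (s j) (t j))"
    and e: "(\<Sum>j. arcdist (s j) (t j)) < e"
    using rdist_less_enum[OF less arcdist_nonneg] .
  let ?d = "\<lambda>j. Arg (s j * cnj (t j))"
  have d: "summable ?d" "\<bar>suminf ?d\<bar> < e"
    using summ e summable_rabs[of ?d] by (auto simp: arcdist_def summable_rabs_cancel)
  have su: "summable (\<lambda>j. Arg (s j))" "summable (\<lambda>j. Arg (t j))"
    using S1T_enum_summable[OF S st(1)] S1T_enum_summable[OF T st(2)] by (auto intro: summable_rabs_cancel)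
  \<comment> \<open>Without \<open>cis\<close> the two sides can differ by a multiple of 2*pi, since
    \<open>Arg\<close> jumps at -1.\<close>
  have cis: "cis (Arg (s j)) = cis (Arg (t j) + ?d j)" for j
  proof -
    have n: "cmod (s j) = 1" "cmod (t j) = 1" using is_enum_S1T_cmod S T st by auto
    have "t j * cnj (t j) = 1" using n by (simp add: complex_norm_square[symmetric])
    then show ?thesis using n
      by (simp add: cis_mult[symmetric] cis_Arg_unit norm_mult mult.left_commute)
  qed
  have "rprod S = cis (\<Sum>j. Arg (t j) + ?d j)"
    unfolding rprod_eq[OF S st(1)] using su d cis by (intro cis_suminf_cong summable_add) auto
  also have "\<dots> = rprod T * cis (suminf ?d)"
    by (simp only: rprod_eq[OF T st(2)] suminf_add[OF su(2) d(1), symmetric] cis_mult)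
  finally have "rprod S - rprod T = rprod T * (cis (suminf ?d) - 1)" by (simp add: algebra_simps)
  then have "dist (rprod S) (rprod T) = cmod (cis (suminf ?d) - 1)"
    by (simp add: dist_norm norm_mult rprod_def)
  also have "\<dots> < e" using norm_cis_minus_one_le d(2) by (rule le_less_trans)
  finally show ?thesis .
qed

lemma rprod_continuous:
  assumes "rcont arcdist D F" "\<And>p. p \<in> D \<Longrightarrow> S1T (F p)"
  shows "continuous_on D (\<lambda>p. rprod (F p))"
  unfolding continuous_on_iff
proof (intro ballI allI impI)
  fix p and e :: real assume p: "p \<in> D" "0 < e"
  obtain d where "d > 0" "\<And>q. q \<in> D \<Longrightarrow> dist q p < d \<Longrightarrow> rdist arcdist (F q) (F p) < ennreal e"
    using assms(1) p unfolding rcont_def by blast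
  then show "\<exists>d>0. \<forall>q\<in>D. dist q p < d \<longrightarrow> dist (rprod (F q)) (rprod (F p)) < e"
    using rprod_dist assms(2) p by blast
qed

section \<open>Branches of a lift: their sum and their images on the circle\<close>

lemma branches_same_mult_off:
  assumes "is_branches a b L th" "r \<in> {a..b}" "is_enum u (L r)"
  shows "same_mult_off 0 u (\<lambda>j. th j r)"
  using assms by (simp add: same_mult_off_def is_branches_def is_enum_def)

lemma branches_summable:
  assumes "is_lift a b S L" "is_branches a b L th" "r \<in> {a..b}"
  shows "summable (\<lambda>j. \<bar>th j r\<bar>)"
proof -
  obtain u where u: "is_enum u (L r)" "summable (\<lambda>j. \<bar>u j\<bar>)"
    using assms S1R_enum unfolding is_lift_def by metis
  show ?thesis
    using same_mult_off_suminf(1)[OF branches_same_mult_off[OF assms(2,3) u(1)], of "\<lambda>x. x"] u by simp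
qed

text \<open>Continuity of each branch does not suffice for an infinite sum. The sum depends only on
  \<open>L r\<close>, so it may be computed along the enumerations that witness a small
  \<open>rdist\<close>, which bounds its change.\<close>

lemma branches_sum_continuous:
  assumes lift: "is_lift a b S L" and br: "is_branches a b L th"
  shows "continuous_on {a..b} (\<lambda>r. \<Sum>j. th j r)"
  unfolding continuous_on_iff
proof (intro ballI allI impI)
  have sum_eq: "summable u \<and> suminf u = (\<Sum>j. th j r)" if "r \<in> {a..b}" "is_enum u (L r)" for r u
    using same_mult_off_suminf[OF same_mult_off_sym[OF branches_same_mult_off[OF br that]], of "\<lambda>x. x"]
      branches_summable[OF lift br that(1)] summable_rabs_cancel[of u] by auto
  fix p e :: real assume p: "p \<in> {a..b}" "0 < e"
  then obtain d where "d > 0" and d: "\<And>q. q \<in> {a..b} \<Longrightarrow> dist q p < d \<Longrightarrow> rdist dist (L q) (L p) < ennreal e"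
    using lift unfolding is_lift_def rcont_def by blast
  moreover have "dist (\<Sum>j. th j q) (\<Sum>j. th j p) < e" if q: "q \<in> {a..b}" "dist q p < d" for q
  proof -
    obtain u v where uv: "is_enum u (L q)" "is_enum v (L p)"
      and e: "summable (\<lambda>j. dist (u j) (v j))" "(\<Sum>j. dist (u j) (v j)) < e"
      using rdist_less_enum[OF d[OF q] zero_le_dist] .
    have "(\<Sum>j. th j q) - (\<Sum>j. th j p) = (\<Sum>j. u j - v j)"
      using sum_eq[OF q(1) uv(1)] sum_eq[OF p(1) uv(2)] suminf_diff[of u v] by simp
    then show ?thesis using e summable_rabs[of "\<lambda>j. u j - v j"] by (simp add: dist_real_def)
  qed
  ultimately show "\<exists>d>0. \<forall>q\<in>{a..b}. dist q p < d \<longrightarrow> dist (\<Sum>j. th j q) (\<Sum>j. th j p) < e"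
    by blast
qed

text \<open>A point other than 1 has no preimage 0 under \<open>cis\<close>, and 0 is the only value
  at which the branches do not determine \<open>L r\<close>.\<close>

lemma branches_cis_same_mult_off:
  assumes lift: "is_lift a b S L" and br: "is_branches a b L th" and r: "r \<in> {a..b}" and s: "is_enum s (S r)"
  shows "same_mult_off 1 (\<lambda>j. cis (th j r)) s"
  unfolding same_mult_off_def
proof (intro allI impI)
  fix z :: complex assume z: "z \<noteq> 1"
  let ?B = "{\<theta>. cis \<theta> = z}"
  have "ecount {j. s j = z} = pmap (L r) z"
    using lift s r by (simp add: is_lift_def is_enum_def)
  also have "\<dots> = (SUP F \<in> {F. finite F \<and> F \<subseteq> ?B}. \<Sum>x\<in>F. ecount {j. th j r = x})"
  proof -
    have "L r x = ecount {j. th j r = x}" if "x \<in> ?B" for x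
    proof -
      have "x \<noteq> 0" using that z by auto
      then show ?thesis using br r by (simp add: is_branches_def)
    qed
    then show ?thesis unfolding pmap_def by (intro SUP_cong sum.cong) auto
  qed
  also have "\<dots> = ecount {j. cis (th j r) = z}" by (simp add: SUP_sum_ecount)
  finally show "ecount {j. cis (th j r) = z} = ecount {j. s j = z}" by simp
qed

lemma cis_branches_sum:
  assumes S: "S1T (S r)" and lift: "is_lift a b S L" and br: "is_branches a b L th" and r: "r \<in> {a..b}"
  shows "cis (\<Sum>j. th j r) = rprod (S r)"
proof -
  obtain s where s: "is_enum s (S r)" "summable (\<lambda>j. \<bar>Arg (s j)\<bar>)" using S1T_enum[OF S] .
  note same = same_mult_off_sym[OF branches_cis_same_mult_off[OF lift br r s(1)]]
  have "cis (\<Sum>j. th j r) = cis (\<Sum>j. Arg (cis (th j r)))"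
    using branches_summable[OF lift br r] same_mult_off_suminf(1)[OF same, of Arg] s(2)
    by (intro cis_suminf_cong) (auto intro: summable_rabs_cancel simp: cis_Arg_unit)
  also have "\<dots> = rprod (S r)"
    using same_mult_off_suminf(2)[OF same, of Arg] s rprod_eq[OF S s(1)] by simp
  finally show ?thesis .
qed

text \<open>A primitive of the bracket, normalised to vanish at 0. It differs from \<open>x / (2\<pi>)\<close> by a
  function of \<open>cis x\<close>, which is why the branches enter \<open>\<mu>\<close> only through their sum.\<close>

definition jump :: "real \<Rightarrow> real \<Rightarrow> real" where
  "jump \<theta> x = (real_of_int \<lfloor>(x - \<theta>) / (2*pi)\<rfloor> + real_of_int \<lceil>(x - \<theta>) / (2*pi)\<rceil> + 1) / 2"

lemma card_int_open: "X < Y \<Longrightarrow> real (card {k::int. X < real_of_int k \<and> real_of_int k < Y}) = real_of_int (\<lceil>Y\<rceil> - \<lfloor>X\<rfloor> - 1)"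
proof -
  assume XY: "X < Y"
  have "{k::int. X < real_of_int k \<and> real_of_int k < Y} = {\<lfloor>X\<rfloor><..<\<lceil>Y\<rceil>}"
    by (auto simp: floor_less_iff less_ceiling_iff)
  moreover have "\<lfloor>X\<rfloor> < \<lceil>Y\<rceil>" using XY by linarith
  ultimately show ?thesis by simp
qed

lemma card_int_closed: "X < Y \<Longrightarrow> real (card {k::int. X \<le> real_of_int k \<and> real_of_int k \<le> Y}) = real_of_int (\<lfloor>Y\<rfloor> - \<lceil>X\<rceil> + 1)"
proof -
  assume XY: "X < Y"
  have "{k::int. X \<le> real_of_int k \<and> real_of_int k \<le> Y} = {\<lceil>X\<rceil>..\<lfloor>Y\<rfloor>}"
    by (auto simp: le_floor_iff ceiling_le_iff)
  moreover have "\<lceil>X\<rceil> \<le> \<lfloor>Y\<rfloor> + 1" using XY by linarith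
  ultimately show ?thesis by simp
qed

text \<open>With \<open>X\<close> and \<open>Y\<close> the rescaled end points, the open count is
  ceiling of \<open>Y\<close> minus floor of \<open>X\<close> minus 1, and the closed count is floor
  of \<open>Y\<close> minus ceiling of \<open>X\<close> plus 1. In the mean the constants cancel and
  the two end points separate; the sign convention for reversed end points follows.\<close>

lemma bracket_eq_jump: "bracket \<theta> x y = jump \<theta> y - jump \<theta> x"
proof -
  have scale: "(x < \<theta> + 2*pi*k) = ((x - \<theta>) / (2*pi) < k)" "(\<theta> + 2*pi*k < x) = (k < (x - \<theta>) / (2*pi))"
    "(x \<le> \<theta> + 2*pi*k) = ((x - \<theta>) / (2*pi) \<le> k)" "(\<theta> + 2*pi*k \<le> x) = (k \<le> (x - \<theta>) / (2*pi))"
    for x k :: real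
    by (auto simp: field_simps)
  have less: "(x - \<theta>) / (2*pi) < (y - \<theta>) / (2*pi)" if "x < y" for x y
    using that by (simp add: divide_strict_right_mono)
  show ?thesis
    using card_int_open[OF less, of x y] card_int_open[OF less, of y x]
      card_int_closed[OF less, of x y] card_int_closed[OF less, of y x]
    unfolding bracket_def scale by (auto simp: jump_def field_simps)
qed

text \<open>The bound on \<open>\<bar>x\<bar>\<close> is the distance from 0 to the nearest point of
  the form \<theta> + 2*pi*k. Hence a null sequence of branches has only finitely many nonzero
  jumps.\<close>

lemma jump_eq_0:
  assumes "\<theta> \<in> {0<..<2*pi}" "\<bar>x\<bar> < min \<theta> (2*pi - \<theta>)"
  shows "jump \<theta> x = 0"
proof -
  have "\<lfloor>(x - \<theta>) / (2*pi)\<rfloor> = -1" "\<lceil>(x - \<theta>) / (2*pi)\<rceil> = 0"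
    using assms by (auto simp: floor_eq_iff ceiling_eq_iff field_simps)
  then show ?thesis by (simp add: jump_def)
qed

definition jump_defect :: "real \<Rightarrow> complex \<Rightarrow> real" where
  "jump_defect \<theta> z = jump \<theta> (Arg z) - Arg z / (2*pi)"

text \<open>Shifting \<open>x\<close> by 2*pi*n raises both \<open>jump \<theta> x\<close> and
  \<open>x / (2*pi)\<close> by \<open>n\<close>, so their difference may be computed at the
  principal argument.\<close>

lemma jump_conv_defect: "jump \<theta> x = x / (2*pi) + jump_defect \<theta> (cis x)"
proof -
  have "cis x = cis (Arg (cis x))" by (simp add: cis_Arg_unit)
  then obtain n :: int where "x = Arg (cis x) + 2*pi*n" unfolding cis_eq_iff ..
  then obtain y where y: "Arg (cis x) = y" "x = y + 2*pi*n" by blast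
  have "(x - \<theta>) / (2*pi) = (y - \<theta>) / (2*pi) + of_int n"
    unfolding y(2) by (simp add: field_simps)
  then have "jump \<theta> x = jump \<theta> y + n"
    by (simp add: jump_def add_divide_distrib)
  then show ?thesis unfolding jump_defect_def y(1) unfolding y(2) by (simp add: add_divide_distrib)
qed

lemma summable_jump:
  assumes "\<theta> \<in> {0<..<2*pi}" "summable (\<lambda>j. \<bar>x j\<bar>)"
  shows "summable (\<lambda>j. \<bar>jump \<theta> (x j)\<bar>)"
proof -
  have "(\<lambda>j. \<bar>x j\<bar>) \<longlonglongrightarrow> 0" using assms(2) by (rule summable_LIMSEQ_zero)
  then have "\<forall>\<^sub>F j in sequentially. \<bar>x j\<bar> < min \<theta> (2*pi - \<theta>)"
    using assms(1) by (intro order_tendstoD) auto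
  then have "\<forall>\<^sub>F j in sequentially. \<bar>jump \<theta> (x j)\<bar> = 0"
    by eventually_elim (use jump_eq_0[OF assms(1)] in simp)
  then show ?thesis using summable_cong[of "\<lambda>j. \<bar>jump \<theta> (x j)\<bar>" "\<lambda>_. 0"] by simp
qed

text \<open>The jumps and the branches are absolutely summable, hence so are the defects. Their sum
  can therefore be taken along any enumeration \<open>s\<close> of the points on the circle, without
  reference to the lift.\<close>

lemma branches_jump_sum:
  assumes \<theta>: "\<theta> \<in> {0<..<2*pi}" and lift: "is_lift a b S L" and br: "is_branches a b L th"
    and r: "r \<in> {a..b}" and s: "is_enum s (S r)"
  shows "summable (\<lambda>j. jump \<theta> (th j r))"
    and "(\<Sum>j. jump \<theta> (th j r)) = (\<Sum>j. th j r) / (2*pi) + (\<Sum>j. jump_defect \<theta> (s j))"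
proof -
  note th = branches_summable[OF lift br r]
  note jump = summable_jump[OF \<theta> th]
  show summ: "summable (\<lambda>j. jump \<theta> (th j r))" using jump by (rule summable_rabs_cancel)
  have "summable (\<lambda>j. \<bar>jump \<theta> (th j r)\<bar> + \<bar>th j r\<bar> / (2*pi))"
    by (intro summable_add jump summable_divide th)
  then have defect: "summable (\<lambda>j. \<bar>jump_defect \<theta> (cis (th j r))\<bar>)"
  proof (rule summable_comparison_test'[where N = 0])
    fix j
    have "jump_defect \<theta> (cis (th j r)) = jump \<theta> (th j r) - th j r / (2*pi)"
      by (simp add: jump_conv_defect)
    then show "norm \<bar>jump_defect \<theta> (cis (th j r))\<bar> \<le> \<bar>jump \<theta> (th j r)\<bar> + \<bar>th j r\<bar> / (2*pi)"
      using abs_triangle_ineq4[of "jump \<theta> (th j r)" "th j r / (2*pi)"] by simp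
  qed
  have zero: "jump_defect \<theta> 1 = 0"
    using jump_eq_0[OF \<theta>, of 0] \<theta> by (simp add: jump_defect_def)
  have "(\<Sum>j. jump \<theta> (th j r)) = (\<Sum>j. th j r / (2*pi) + jump_defect \<theta> (cis (th j r)))"
    by (simp add: jump_conv_defect[symmetric])
  also have "\<dots> = (\<Sum>j. th j r / (2*pi)) + (\<Sum>j. jump_defect \<theta> (cis (th j r)))"
    using th defect by (intro suminf_add[symmetric] summable_divide) (auto intro: summable_rabs_cancel)
  also have "(\<Sum>j. th j r / (2*pi)) = (\<Sum>j. th j r) / (2*pi)"
    using th by (intro suminf_divide) (auto intro: summable_rabs_cancel)
  also have "(\<Sum>j. jump_defect \<theta> (cis (th j r))) = (\<Sum>j. jump_defect \<theta> (s j))"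
    using same_mult_off_suminf(2)[OF branches_cis_same_mult_off[OF lift br r s] zero defect] by simp
  finally show "(\<Sum>j. jump \<theta> (th j r)) = (\<Sum>j. th j r) / (2*pi) + (\<Sum>j. jump_defect \<theta> (s j))" .
qed

lemma bracket_sum:
  assumes \<theta>: "\<theta> \<in> {0<..<2*pi}" and lift: "is_lift a b S L" and br: "is_branches a b L th"
    and ab: "a \<le> b" and s: "is_enum s (S a)" "is_enum t (S b)"
  shows "(\<Sum>j. bracket \<theta> (th j a) (th j b)) = ((\<Sum>j. th j b) - (\<Sum>j. th j a)) / (2*pi)
           + ((\<Sum>j. jump_defect \<theta> (t j)) - (\<Sum>j. jump_defect \<theta> (s j)))"
proof -
  have r: "a \<in> {a..b}" "b \<in> {a..b}" using ab by auto
  have "(\<Sum>j. bracket \<theta> (th j a) (th j b)) = (\<Sum>j. jump \<theta> (th j b)) - (\<Sum>j. jump \<theta> (th j a))"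
    unfolding bracket_eq_jump
    by (intro suminf_diff[symmetric] branches_jump_sum(1)[OF \<theta> lift br _ s(2)] branches_jump_sum(1)[OF \<theta> lift br _ s(1)] r)
  then show ?thesis
    using branches_jump_sum(2)[OF \<theta> lift br r(1) s(1)] branches_jump_sum(2)[OF \<theta> lift br r(2) s(2)]
    by (simp add: diff_divide_distrib)
qed

section \<open>Continuous arguments and their increments over a homotopy\<close>

lemma cis_lift_unique:
  fixes f g :: "real \<Rightarrow> real"
  assumes ab: "a \<le> b" and f: "continuous_on {a..b} f" and g: "continuous_on {a..b} g"
    and eq: "\<And>r. r \<in> {a..b} \<Longrightarrow> cis (f r) = cis (g r)"
  shows "f b - f a = g b - g a"
proof -
  \<comment> \<open>The difference takes values in the multiples of 2*pi, which are 2*pi apart, and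
    the interval is connected.\<close>
  have "(\<lambda>r. f r - g r) constant_on {a..b}"
  proof (rule continuous_discrete_range_constant)
    fix x assume x: "x \<in> {a..b}"
    have "\<exists>n::int. f r - g r = 2*pi*n" if "r \<in> {a..b}" for r
      using eq[OF that] unfolding cis_eq_iff by (auto simp: algebra_simps)
    then obtain n :: "real \<Rightarrow> int" where n: "\<And>r. r \<in> {a..b} \<Longrightarrow> f r - g r = 2*pi*n r" by metis
    have "2*pi \<le> norm (f y - g y - (f x - g x))" if "y \<in> {a..b}" "f y - g y \<noteq> f x - g x" for y
    proof -
      have "n y \<noteq> n x" using that n x by auto
      then have "1 \<le> \<bar>real_of_int (n y - n x)\<bar>" by linarith
      then have "2*pi*1 \<le> 2*pi*\<bar>real_of_int (n y - n x)\<bar>" by (intro mult_left_mono) auto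
      also have "\<dots> = \<bar>2*pi*n y - 2*pi*n x\<bar>" by (simp add: abs_mult flip: right_diff_distrib)
      finally show ?thesis using n that x by simp
    qed
    then show "\<exists>e>0. \<forall>y. y \<in> {a..b} \<and> f y - g y \<noteq> f x - g x \<longrightarrow> e \<le> norm (f y - g y - (f x - g x))"
      by (intro exI[of _ "2*pi"]) auto
  qed (auto intro: continuous_intros f g)
  then obtain c where "\<And>r. r \<in> {a..b} \<Longrightarrow> f r - g r = c" unfolding constant_on_def by blast
  from this[of a] this[of b] show ?thesis using ab by simp
qed

text \<open>The order of the quantifiers carries the homotopy invariance: \<open>c\<close> is fixed
  before \<open>t\<close> and before the argument \<open>f\<close>. It is the increment of one
  continuous argument defined on the whole rectangle.\<close>

lemma homotopy_lift_increment:
  fixes D :: "real \<times> real \<Rightarrow> complex"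
  assumes ab: "a \<le> b" and D: "continuous_on ({a..b} \<times> {0..1}) D" and unit: "\<And>p. cmod (D p) = 1"
    and left: "\<And>t. t \<in> {0..1} \<Longrightarrow> D (a, t) = D (a, 0)" and right: "\<And>t. t \<in> {0..1} \<Longrightarrow> D (b, t) = D (b, 0)"
  shows "\<exists>c. \<forall>t\<in>{0..1}. \<forall>f. continuous_on {a..b} f
    \<longrightarrow> (\<forall>r\<in>{a..b}. cis (f r) = D (r, t)) \<longrightarrow> f b - f a = c"
proof -
  have "contractible ({a..b} \<times> {0..1::real})"
    by (intro convex_imp_contractible convex_Times) auto
  then obtain g where g: "continuous_on ({a..b} \<times> {0..1}) g"
      "\<And>p. p \<in> {a..b} \<times> {0..1} \<Longrightarrow> D p = exp (g p)"
    using continuous_logarithm_on_contractible[OF D] unit by (metis norm_zero zero_neq_one)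
  define \<psi> where "\<psi> = (\<lambda>p. Im (g p))"
  have \<psi>: "continuous_on ({a..b} \<times> {0..1}) \<psi>"
    unfolding \<psi>_def by (intro continuous_intros g)
  have cis: "cis (\<psi> p) = D p" if "p \<in> {a..b} \<times> {0..1}" for p
  proof -
    have "exp (Re (g p)) = 1" using unit[of p] g(2)[OF that] by simp
    then show ?thesis using g(2)[OF that] exp_eq_polar[of "g p"] by (simp add: \<psi>_def)
  qed
  have comp: "continuous_on A (\<lambda>r. \<psi> (h r))" if "continuous_on A h" "h ` A \<subseteq> {a..b} \<times> {0..1}" for A :: "real set" and h
    using continuous_on_compose2[OF \<psi> that] .
  \<comment> \<open>Along an edge where \<open>D\<close> is constant, a constant function is another
    continuous argument, so uniqueness makes \<psi> constant there.\<close>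
  have vert: "\<psi> (r, t) = \<psi> (r, 0)" if "t \<in> {0..1}" "r \<in> {a..b}" "\<And>t. t \<in> {0..1} \<Longrightarrow> D (r, t) = D (r, 0)" for r t
  proof -
    have "\<psi> (r, t) - \<psi> (r, 0) = \<psi> (r, 0) - \<psi> (r, 0)"
    proof (rule cis_lift_unique[where f = "\<lambda>t. \<psi> (r, t)" and g = "\<lambda>_. \<psi> (r, 0)"])
      show "continuous_on {0..t} (\<lambda>t. \<psi> (r, t))"
        by (intro comp continuous_intros) (use that in auto)
      fix t' assume "t' \<in> {0..t}"
      with that(1) have "t' \<in> {0..1}" by simp
      then show "cis (\<psi> (r, t')) = cis (\<psi> (r, 0))"
        using cis[of "(r, t')"] cis[of "(r, 0)"] that(2) that(3)[of t'] by simp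
    qed (use that in auto)
    then show ?thesis by simp
  qed
  show ?thesis
  proof (intro exI ballI allI impI)
    fix f t assume t: "t \<in> {0..1::real}" and f: "continuous_on {a..b} f" "\<forall>r\<in>{a..b}. cis (f r) = D (r, t)"
    have "f b - f a = \<psi> (b, t) - \<psi> (a, t)"
    proof (rule cis_lift_unique[OF ab f(1), where g = "\<lambda>r. \<psi> (r, t)"])
      show "continuous_on {a..b} (\<lambda>r. \<psi> (r, t))"
        by (intro comp continuous_intros) (use t in auto)
      show "\<And>r. r \<in> {a..b} \<Longrightarrow> cis (f r) = cis (\<psi> (r, t))" using f(2) cis t by simp
    qed
    also have "\<dots> = \<psi> (b, 0) - \<psi> (a, 0)"
      using vert[OF t _ right] vert[OF t _ left] ab by (metis atLeastAtMost_iff order_refl)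
    finally show "f b - f a = \<psi> (b, 0) - \<psi> (a, 0)" .
  qed
qed

section \<open>Existence of lifts\<close>

text \<open>Values in \<open>ennreal\<close> match \<open>rdist\<close> and make sums and reindexing
  free of summability conditions.\<close>

definition l1dist :: "(nat \<Rightarrow> real) \<Rightarrow> (nat \<Rightarrow> real) \<Rightarrow> ennreal" where
  "l1dist u v = (\<Sum>j. ennreal \<bar>u j - v j\<bar>)"

lemma suminf_ennreal_bij:
  fixes f :: "nat \<Rightarrow> ennreal"
  assumes "bij \<pi>"
  shows "(\<Sum>j. f (\<pi> j)) = (\<Sum>j. f j)"
  using nn_integral_bij_count_space[OF assms, of f] by (simp add: nn_integral_count_space_nat)

lemma l1dist_le_suminf:
  assumes "summable g" "\<And>j. \<bar>u j - v j\<bar> \<le> g j"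
  shows "l1dist u v \<le> ennreal (suminf g)"
proof -
  have nonneg: "0 \<le> g j" for j using assms(2)[of j] by linarith
  have "l1dist u v \<le> (\<Sum>j. ennreal (g j))"
    unfolding l1dist_def using assms(2) by (intro suminf_le summableI ennreal_leI)
  also have "\<dots> = ennreal (suminf g)" using nonneg assms(1) by (rule suminf_ennreal2)
  finally show ?thesis .
qed

lemma is_enum_comp_bij:
  assumes "bij \<pi>" "is_enum u S"
  shows "is_enum (\<lambda>j. u (\<pi> j)) S"
  unfolding is_enum_def
proof
  fix x
  have "bij_betw \<pi> {j. u (\<pi> j) = x} {j. u j = x}"
    using assms by (auto simp: bij_betw_def bij_def inj_on_def image_iff)
  then show "ecount {j. u (\<pi> j) = x} = S x"
    using ecount_bij assms(2) unfolding is_enum_def by metis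
qed

definition l1_continuous_on :: "real set \<Rightarrow> (real \<Rightarrow> nat \<Rightarrow> real) \<Rightarrow> bool" where
  "l1_continuous_on D y \<longleftrightarrow>
     (\<forall>p\<in>D. \<forall>e>0. \<exists>d>0. \<forall>q\<in>D. dist q p < d \<longrightarrow> l1dist (y q) (y p) < ennreal e)"

definition angles_of :: "(nat \<Rightarrow> real) \<Rightarrow> complex rigged \<Rightarrow> bool" where
  "angles_of x S \<longleftrightarrow> summable (\<lambda>j. \<bar>x j\<bar>) \<and> is_enum (\<lambda>j. cis (x j)) S"

text \<open>A lift together with a fixed labelling of its points, so that one map into l1 supplies
  both the lift and its branches.\<close>

definition l1_lift :: "real set \<Rightarrow> (real \<Rightarrow> complex rigged) \<Rightarrow> (real \<Rightarrow> nat \<Rightarrow> real) \<Rightarrow> bool" where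
  "l1_lift D S y \<longleftrightarrow> l1_continuous_on D y \<and> (\<forall>r\<in>D. angles_of (y r) (S r))"

text \<open>Two angle sequences for \<open>S c\<close> differ by a permutation and by multiples of
  2*pi. This correction does not depend on \<open>r\<close>, so all l1-distances persist; the shift
  is summable because both sequences are.\<close>

lemma l1_lift_initial:
  assumes lift: "l1_lift D S y" and c: "c \<in> D" and x: "angles_of x (S c)"
  shows "\<exists>y'. l1_lift D S y' \<and> y' c = x"
proof -
  have yc: "is_enum (\<lambda>j. cis (y c j)) (S c)" using lift c by (simp add: l1_lift_def angles_of_def)
  obtain \<pi> where \<pi>: "bij \<pi>" "\<And>j. cis (y c (\<pi> j)) = cis (x j)"
    using is_enum_bij[OF x[unfolded angles_of_def, THEN conjunct2] yc] by blast
  define y' where "y' = (\<lambda>r j. y r (\<pi> j) + (x j - y c (\<pi> j)))"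
  have reindex: "summable (\<lambda>j. \<bar>y r (\<pi> j)\<bar>)" if "r \<in> D" for r
    using same_mult_off_suminf(1)[OF same_mult_off_sym[OF same_mult_off_bij[OF \<pi>(1), of 0 "y r"]], of "\<lambda>x. x"]
      lift that by (simp add: l1_lift_def angles_of_def)
  have l1: "l1dist (y' q) (y' p) = l1dist (y q) (y p)" for p q
    using suminf_ennreal_bij[OF \<pi>(1), of "\<lambda>j. ennreal \<bar>y q j - y p j\<bar>"] by (simp add: l1dist_def y'_def)
  have "angles_of (y' r) (S r)" if r: "r \<in> D" for r
    unfolding angles_of_def
  proof
    have "summable (\<lambda>j. \<bar>y r (\<pi> j)\<bar> + (\<bar>x j\<bar> + \<bar>y c (\<pi> j)\<bar>))"
      using x reindex[OF r] reindex[OF c] by (intro summable_add) (auto simp: angles_of_def)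
    then show "summable (\<lambda>j. \<bar>y' r j\<bar>)"
      by (rule summable_comparison_test'[where N = 0]) (simp add: y'_def)
    have "cis (y' r j) = cis (y r (\<pi> j))" for j
      by (simp add: y'_def cis_mult[symmetric] cis_divide[symmetric] \<pi>(2))
    moreover have "is_enum (\<lambda>j. cis (y r (\<pi> j))) (S r)"
      using lift r is_enum_comp_bij[OF \<pi>(1), of "\<lambda>j. cis (y r j)"] by (simp add: l1_lift_def angles_of_def)
    ultimately show "is_enum (\<lambda>j. cis (y' r j)) (S r)" by simp
  qed
  then have "l1_lift D S y'" using lift by (simp add: l1_lift_def l1_continuous_on_def l1)
  moreover have "y' c = x" by (simp add: y'_def)
  ultimately show ?thesis by blast
qed

lemma l1_lift_glue:
  assumes y: "l1_lift {c..m} S y" and z: "l1_lift {m..e} S z" and eq: "y m = z m"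
  shows "l1_lift {c..e} S (\<lambda>r. if r \<le> m then y r else z r)" (is "l1_lift _ _ ?w")
proof -
  have ang: "angles_of (?w r) (S r)" if "r \<in> {c..e}" for r
    using y z that by (auto simp: l1_lift_def)
  have "\<exists>d>0. \<forall>q\<in>{c..e}. dist q p < d \<longrightarrow> l1dist (?w q) (?w p) < ennreal \<epsilon>"
    if p: "p \<in> {c..e}" and \<epsilon>: "0 < \<epsilon>" for p \<epsilon>
  proof -
    have wz: "?w q = z q" if "m \<le> q" for q using that eq by auto
    have left: "\<exists>d>0. \<forall>q\<in>{c..m}. dist q p < d \<longrightarrow> l1dist (y q) (y p) < ennreal \<epsilon>" if "p \<le> m"
      using y p \<epsilon> that by (auto simp: l1_lift_def l1_continuous_on_def)
    have right: "\<exists>d>0. \<forall>q\<in>{m..e}. dist q p < d \<longrightarrow> l1dist (z q) (z p) < ennreal \<epsilon>" if "m \<le> p"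
      using z p \<epsilon> that by (auto simp: l1_lift_def l1_continuous_on_def)
    consider "p < m" | "p = m" | "m < p" by linarith
    then show ?thesis
    proof cases
      case 1
      with left obtain d where d: "d > 0" "\<And>q. q \<in> {c..m} \<Longrightarrow> dist q p < d \<Longrightarrow> l1dist (y q) (y p) < ennreal \<epsilon>"
        by (meson less_imp_le)
      show ?thesis
      proof (intro exI[of _ "min d (m - p)"] conjI ballI impI)
        fix q assume "q \<in> {c..e}" "dist q p < min d (m - p)"
        then show "l1dist (?w q) (?w p) < ennreal \<epsilon>" using d(2)[of q] 1 by (auto simp: dist_real_def)
      qed (use d 1 in auto)
    next
      case 2
      obtain d where d: "d > 0" "\<And>q. q \<in> {c..m} \<Longrightarrow> dist q p < d \<Longrightarrow> l1dist (y q) (y p) < ennreal \<epsilon>"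
        using left 2 by (meson order_refl)
      obtain d' where d': "d' > 0" "\<And>q. q \<in> {m..e} \<Longrightarrow> dist q p < d' \<Longrightarrow> l1dist (z q) (z p) < ennreal \<epsilon>"
        using right 2 by (meson order_refl)
      show ?thesis
      proof (intro exI[of _ "min d d'"] conjI ballI impI)
        fix q assume "q \<in> {c..e}" "dist q p < min d d'"
        then show "l1dist (?w q) (?w p) < ennreal \<epsilon>" using d(2)[of q] d'(2)[of q] 2 eq by auto
      qed (use d d' in auto)
    next
      case 3
      with right obtain d where d: "d > 0" "\<And>q. q \<in> {m..e} \<Longrightarrow> dist q p < d \<Longrightarrow> l1dist (z q) (z p) < ennreal \<epsilon>"
        by (meson less_imp_le)
      show ?thesis
      proof (intro exI[of _ "min d (p - m)"] conjI ballI impI)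
        fix q assume "q \<in> {c..e}" "dist q p < min d (p - m)"
        then show "l1dist (?w q) (?w p) < ennreal \<epsilon>" using d(2)[of q] 3 by (auto simp: dist_real_def)
      qed (use d 3 in auto)
    qed
  qed
  with ang show ?thesis unfolding l1_lift_def l1_continuous_on_def by blast
qed

text \<open>The third stream of zeros secures infinite multiplicity at the base point.\<close>

definition weave :: "(nat \<Rightarrow> real) \<Rightarrow> (nat \<Rightarrow> real) \<Rightarrow> nat \<Rightarrow> real" where
  "weave f g j = (if j mod 3 = 0 then f (j div 3) else if j mod 3 = 1 then - g (j div 3) else 0)"

lemma weave_simps:
  "weave f g (3 * k) = f k" "weave f g (3 * k + 1) = - g k" "weave f g (3 * k + 2) = 0"
proof -
  have "(3 * k + 1) mod 3 = 1" "(3 * k + 2) mod 3 = 2" "(3 * k + 1) div 3 = k" for k :: nat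
    by presburger+
  then show "weave f g (3 * k) = f k" "weave f g (3 * k + 1) = - g k" "weave f g (3 * k + 2) = 0"
    unfolding weave_def by simp_all
qed

lemma l1dist_weave: "l1dist (weave f g) (weave f' g') = l1dist f f' + l1dist g g'"
proof -
  \<comment> \<open>\<open>h i u\<close> spreads \<open>u\<close> over the indices congruent to
    \<open>i\<close> modulo 3, so the series splits without rearrangement.\<close>
  define h where "h = (\<lambda>(i::nat) (u :: nat \<Rightarrow> real) j. if j mod 3 = i then ennreal \<bar>u (j div 3)\<bar> else 0)"
  have h: "(\<Sum>j. h i u j) = (\<Sum>j. ennreal \<bar>u j\<bar>)" if "i < 3" for i u
  proof -
    have "(\<Sum>k. h i u (3 * k + i)) = (\<Sum>j. h i u j)"
    proof (rule suminf_mono_reindex)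
      show "strict_mono (\<lambda>k. 3 * k + i)" by (simp add: strict_mono_def)
      fix n assume n: "n \<notin> range (\<lambda>k. 3 * k + i)"
      have "n mod 3 \<noteq> i"
      proof
        assume "n mod 3 = i"
        then have "n = 3 * (n div 3) + i" using mult_div_mod_eq[of 3 n] by simp
        with n show False by blast
      qed
      then show "h i u n = 0" by (simp add: h_def)
    qed
    moreover have "(3 * k + i) mod 3 = i" "(3 * k + i) div 3 = k" for k
      using that by simp_all
    then have "h i u (3 * k + i) = ennreal \<bar>u k\<bar>" for k unfolding h_def by simp
    ultimately show ?thesis by simp
  qed
  have "ennreal \<bar>weave f g j - weave f' g' j\<bar> = h 0 (\<lambda>j. f j - f' j) j + h 1 (\<lambda>j. g j - g' j) j" for j
    by (auto simp: weave_def h_def abs_minus_commute)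
  then have "l1dist (weave f g) (weave f' g') = (\<Sum>j. h 0 (\<lambda>j. f j - f' j) j) + (\<Sum>j. h 1 (\<lambda>j. g j - g' j) j)"
    unfolding l1dist_def by (simp add: suminf_add summableI)
  then show ?thesis by (simp add: h l1dist_def)
qed

text \<open>Both inputs are nonnegative, so a positive value can come only from the first stream and
  a negative one only from the second.\<close>

lemma weave_same_mult_off:
  assumes f: "same_mult_off 0 f (\<lambda>j. max 0 (x j))" "\<And>j. 0 \<le> f j"
    and g: "same_mult_off 0 g (\<lambda>j. max 0 (- x j))" "\<And>j. 0 \<le> g j"
  shows "same_mult_off 0 (weave f g) x"
  unfolding same_mult_off_def
proof (intro allI impI)
  fix v :: real assume "v \<noteq> 0"
  then consider "0 < v" | "v < 0" by linarith
  then show "ecount {j. weave f g j = v} = ecount {j. x j = v}"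
  proof cases
    case 1
    have "{j. weave f g j = v} = (\<lambda>k. 3 * k) ` {k. f k = v}"
    proof (intro equalityI subsetI)
      fix j assume "j \<in> {j. weave f g j = v}"
      moreover have "- g (j div 3) \<noteq> v" using g(2)[of "j div 3"] 1 by linarith
      ultimately have "j mod 3 = 0" "f (j div 3) = v" using 1 by (auto simp: weave_def split: if_splits)
      then show "j \<in> (\<lambda>k. 3 * k) ` {k. f k = v}"
        by (intro image_eqI[of _ _ "j div 3"]) auto
    qed (auto simp: weave_simps)
    then have "ecount {j. weave f g j = v} = ecount {k. f k = v}"
      by (intro ecount_bij[symmetric, of "\<lambda>k. 3 * k"] bij_betw_imageI) (auto simp: inj_on_def)
    also have "\<dots> = ecount {j. max 0 (x j) = v}" using f(1) 1 by (simp add: same_mult_off_def)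
    also have "{j. max 0 (x j) = v} = {j. x j = v}" using 1 by auto
    finally show ?thesis .
  next
    case 2
    have "{j. weave f g j = v} = (\<lambda>k. 3 * k + 1) ` {k. g k = - v}"
    proof (intro equalityI subsetI)
      fix j assume "j \<in> {j. weave f g j = v}"
      moreover have "f (j div 3) \<noteq> v" using f(2)[of "j div 3"] 2 by linarith
      ultimately have "j mod 3 = 1" "g (j div 3) = - v" using 2 by (auto simp: weave_def split: if_splits)
      then show "j \<in> (\<lambda>k. 3 * k + 1) ` {k. g k = - v}"
        using mult_div_mod_eq[of 3 j] by (intro image_eqI[of _ _ "j div 3"]) auto
    qed (auto simp: weave_simps(2)[unfolded One_nat_def add_Suc_right add_0_right])
    then have "ecount {j. weave f g j = v} = ecount {k. g k = - v}"
      by (intro ecount_bij[symmetric, of "\<lambda>k. 3 * k + 1"] bij_betw_imageI) (auto simp: inj_on_def)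
    also have "\<dots> = ecount {j. max 0 (- x j) = - v}" using g(1) 2 by (simp add: same_mult_off_def)
    also have "{j. max 0 (- x j) = - v} = {j. x j = v}" using 2 by auto
    finally show ?thesis .
  qed
qed

lemma weave_zero_infinite: "infinite {j. weave f g j = 0}"
proof -
  have "infinite (range (\<lambda>k::nat. 3 * k + 2))" by (rule range_inj_infinite) (simp add: inj_def)
  moreover have "range (\<lambda>k::nat. 3 * k + 2) \<subseteq> {j. weave f g j = 0}"
    using weave_simps(3) by blast
  ultimately show ?thesis by (meson infinite_super)
qed

text \<open>The angle of a point of the circle that has been cut open at the point of angle \<open>\<pi> - \<gamma>\<close>,
  normalised so that the base point 1 has angle 0.\<close>

definition cut_angle :: "real \<Rightarrow> complex \<Rightarrow> real" where
  "cut_angle \<gamma> z = Arg (z * cis \<gamma>) - \<gamma>"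

text \<open>The points of the circle at arc distance at least \<eta> from the cut.\<close>

definition off_cut :: "real \<Rightarrow> real \<Rightarrow> complex set" where
  "off_cut \<gamma> \<eta> = {z. cmod z = 1 \<and> \<bar>Arg (z * cis \<gamma>)\<bar> \<le> pi - \<eta>}"

section \<open>Angles on the circle cut open\<close>

lemma cis_cut_angle: "cmod z = 1 \<Longrightarrow> cis (cut_angle \<gamma> z) = z"
  by (simp add: cut_angle_def cis_divide[symmetric] cis_Arg_unit norm_mult)

lemma Arg_cis_small: "0 < \<gamma> \<Longrightarrow> \<gamma> < 1 \<Longrightarrow> Arg (cis \<gamma>) = \<gamma>"
  using pi_gt3 by (intro Arg_cis) auto

lemma cis_Arg_diff:
  assumes "cmod z = 1" "cmod w = 1"
  shows "cis (Arg (z * cis \<gamma>)) = cis (Arg (w * cis \<gamma>) + Arg (z * cnj w))"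
proof -
  have "w * cnj w = 1" using assms by (simp add: complex_norm_square[symmetric])
  then show ?thesis
    using assms by (simp add: cis_mult[symmetric] cis_Arg_unit norm_mult mult.left_commute mult.commute)
qed

text \<open>The difference of the two angles is the signed arc up to 2*pi*n. An arc shorter than
  \<eta> cannot cross the cut, so \<open>n = 0\<close>; for a longer arc the trivial bound 2*pi is
  at most 2*pi/\<eta> times its length.\<close>

lemma cut_angle_lipschitz:
  assumes \<eta>: "0 < \<eta>" and z: "z \<in> off_cut \<gamma> \<eta>" and w: "w \<in> off_cut \<gamma> \<eta>"
  shows "\<bar>cut_angle \<gamma> z - cut_angle \<gamma> w\<bar> \<le> 2*pi/\<eta> * arcdist z w"
proof -
  let ?A = "Arg (z * cis \<gamma>)" and ?B = "Arg (w * cis \<gamma>)" and ?\<xi> = "Arg (z * cnj w)"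
  have AB: "\<bar>?A - ?B\<bar> \<le> 2*pi - 2*\<eta>" using z w by (auto simp: off_cut_def)
  then have "\<eta> \<le> pi" by linarith
  obtain n :: int where n: "?A = ?B + ?\<xi> + 2*pi*n"
    using cis_Arg_diff[of z w \<gamma>] z w unfolding cis_eq_iff by (auto simp: off_cut_def)
  have "\<bar>?A - ?B\<bar> \<le> 2*pi/\<eta> * \<bar>?\<xi>\<bar>"
  proof (cases "\<bar>?\<xi>\<bar> < \<eta>")
    case True
    have "\<bar>2*pi*n\<bar> < 2*pi * 1" using AB n True \<eta> by linarith
    then have "\<bar>real_of_int n\<bar> < 1" by (simp add: abs_mult)
    then have "n = 0" by linarith
    then have "\<bar>?A - ?B\<bar> = 1 * \<bar>?\<xi>\<bar>" using n by simp
    also have "\<dots> \<le> 2*pi/\<eta> * \<bar>?\<xi>\<bar>" using \<eta> \<open>\<eta> \<le> pi\<close> by (intro mult_right_mono) auto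
    finally show ?thesis .
  next
    case False
    have "\<bar>?A - ?B\<bar> \<le> 2*pi/\<eta> * \<eta>" using AB \<eta> by simp
    also have "\<dots> \<le> 2*pi/\<eta> * \<bar>?\<xi>\<bar>" using False \<eta> by (intro mult_left_mono) auto
    finally show ?thesis .
  qed
  then show ?thesis by (simp add: cut_angle_def arcdist_def)
qed

text \<open>A null sequence with infinitely many terms of each sign has no monotone listing, so the
  two signs are sorted separately.\<close>

definition sorted_angles :: "real \<Rightarrow> (nat \<Rightarrow> complex) \<Rightarrow> nat \<Rightarrow> real" where
  "sorted_angles \<gamma> s = weave (kth_largest (\<lambda>j. max 0 (cut_angle \<gamma> (s j))))
                              (kth_largest (\<lambda>j. max 0 (- cut_angle \<gamma> (s j))))"

text \<open>The labelling depends on the rigged set alone, so enumerations that witness a small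
  distance may be substituted freely, although they change from pair to pair.\<close>

lemma sorted_angles_unique:
  assumes "is_enum s S" "is_enum t S"
  shows "sorted_angles \<gamma> s = sorted_angles \<gamma> t"
proof -
  obtain \<pi> where \<pi>: "bij \<pi>" "\<And>j. t (\<pi> j) = s j"
    using is_enum_bij[OF assms] by blast
  show ?thesis
    using kth_largest_cong_bij[OF \<pi>(1), of "\<lambda>j. max 0 (cut_angle \<gamma> (t j))"]
      kth_largest_cong_bij[OF \<pi>(1), of "\<lambda>j. max 0 (- cut_angle \<gamma> (t j))"]
    by (simp add: sorted_angles_def \<pi>(2))
qed

lemma summable_cut_angle:
  assumes \<gamma>: "0 < \<gamma>" "\<gamma> < 1" and \<eta>: "0 < \<eta>" "\<eta> \<le> 1"
    and s: "range s \<subseteq> off_cut \<gamma> \<eta>" "summable (\<lambda>j. \<bar>Arg (s j)\<bar>)"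
  shows "summable (\<lambda>j. \<bar>cut_angle \<gamma> (s j)\<bar>)"
proof -
  \<comment> \<open>The base point is off the cut since \<gamma> < 1 < pi - \<eta>. Comparing with
    it turns the Lipschitz bound into a summable majorant.\<close>
  have one: "1 \<in> off_cut \<gamma> \<eta>" "cut_angle \<gamma> 1 = 0"
    using \<gamma> \<eta> pi_gt3 by (auto simp: off_cut_def cut_angle_def Arg_cis_small)
  have "summable (\<lambda>j. 2*pi/\<eta> * \<bar>Arg (s j)\<bar>)" using s(2) by (rule summable_mult)
  then show ?thesis
  proof (rule summable_comparison_test'[where N = 0])
    fix j
    show "norm \<bar>cut_angle \<gamma> (s j)\<bar> \<le> 2*pi/\<eta> * \<bar>Arg (s j)\<bar>"
      using cut_angle_lipschitz[OF \<eta>(1) _ one(1), of "s j"] s(1) one(2) by auto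
  qed
qed

lemma l1dist_sorted_angles:
  assumes \<gamma>: "0 < \<gamma>" "\<gamma> < 1" and \<eta>: "0 < \<eta>" "\<eta> \<le> 1"
    and s: "range s \<subseteq> off_cut \<gamma> \<eta>" "summable (\<lambda>j. \<bar>Arg (s j)\<bar>)"
    and t: "range t \<subseteq> off_cut \<gamma> \<eta>" "summable (\<lambda>j. \<bar>Arg (t j)\<bar>)"
    and st: "summable (\<lambda>j. arcdist (s j) (t j))"
  shows "l1dist (sorted_angles \<gamma> s) (sorted_angles \<gamma> t) \<le> ennreal (4*pi/\<eta> * (\<Sum>j. arcdist (s j) (t j)))"
proof -
  let ?C = "2*pi/\<eta> * (\<Sum>j. arcdist (s j) (t j))"
  note cs = summable_cut_angle[OF \<gamma> \<eta> s] and ct = summable_cut_angle[OF \<gamma> \<eta> t]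
  \<comment> \<open>The values 1 and -1 of \<sigma> give the positive and the negative stream. Each
    contributes 2*pi/\<eta>, whence the constant 4*pi/\<eta>.\<close>
  have part: "l1dist (kth_largest (\<lambda>j. max 0 (\<sigma> * cut_angle \<gamma> (s j)))) (kth_largest (\<lambda>j. max 0 (\<sigma> * cut_angle \<gamma> (t j))))
      \<le> ennreal ?C" if \<sigma>: "\<bar>\<sigma>\<bar> = 1" for \<sigma> :: real
  proof -
    let ?u = "\<lambda>j. max 0 (\<sigma> * cut_angle \<gamma> (s j))" and ?v = "\<lambda>j. max 0 (\<sigma> * cut_angle \<gamma> (t j))"
    have le: "max 0 (\<sigma> * x) \<le> \<bar>x\<bar>" for x
      using \<sigma> abs_mult[of \<sigma> x] abs_ge_self[of "\<sigma> * x"] by (simp add: max_def)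
    have u: "summable ?u"
      by (rule summable_comparison_test'[OF cs, of 0]) (use le in simp)
    have v: "summable ?v"
      by (rule summable_comparison_test'[OF ct, of 0]) (use le in simp)
    note contr = kth_largest_l1_contraction[OF u _ v, simplified]
    have pt: "\<bar>?u j - ?v j\<bar> \<le> 2*pi/\<eta> * arcdist (s j) (t j)" for j
    proof -
      have "\<bar>?u j - ?v j\<bar> \<le> \<bar>\<sigma> * cut_angle \<gamma> (s j) - \<sigma> * cut_angle \<gamma> (t j)\<bar>" by linarith
      also have "\<dots> = \<bar>cut_angle \<gamma> (s j) - cut_angle \<gamma> (t j)\<bar>"
        using \<sigma> by (simp add: abs_mult flip: right_diff_distrib)
      also have "\<dots> \<le> 2*pi/\<eta> * arcdist (s j) (t j)"
        using s(1) t(1) by (intro cut_angle_lipschitz \<eta>) auto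
      finally show ?thesis .
    qed
    have sC: "summable (\<lambda>j. 2*pi/\<eta> * arcdist (s j) (t j))" using st by (rule summable_mult)
    have suv: "summable (\<lambda>j. \<bar>?u j - ?v j\<bar>)"
      by (rule summable_comparison_test'[OF sC, of 0]) (use pt in auto)
    have "l1dist (kth_largest ?u) (kth_largest ?v) \<le> ennreal (\<Sum>j. \<bar>kth_largest ?u j - kth_largest ?v j\<bar>)"
      using contr(1) by (intro l1dist_le_suminf) auto
    also have "\<dots> \<le> ennreal ?C"
    proof (rule ennreal_leI)
      have "(\<Sum>j. \<bar>kth_largest ?u j - kth_largest ?v j\<bar>) \<le> (\<Sum>j. \<bar>?u j - ?v j\<bar>)" by (rule contr(2))
      also have "\<dots> \<le> (\<Sum>j. 2*pi/\<eta> * arcdist (s j) (t j))" by (rule suminf_le[OF pt suv sC])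
      also have "\<dots> = ?C" using st by (rule suminf_mult)
      finally show "(\<Sum>j. \<bar>kth_largest ?u j - kth_largest ?v j\<bar>) \<le> ?C" .
    qed
    finally show ?thesis .
  qed
  have nonneg: "0 \<le> ?C" using \<eta> st by (intro mult_nonneg_nonneg suminf_nonneg) (auto simp: arcdist_def)
  have "l1dist (sorted_angles \<gamma> s) (sorted_angles \<gamma> t) \<le> ennreal ?C + ennreal ?C"
    unfolding sorted_angles_def l1dist_weave using part[of 1] part[of "-1"] by (intro add_mono) simp_all
  also have "\<dots> = ennreal (?C + ?C)" using nonneg by (intro ennreal_plus[symmetric])
  also have "?C + ?C = 4*pi/\<eta> * (\<Sum>j. arcdist (s j) (t j))" by (simp add: field_simps)
  finally show ?thesis .
qed

lemma angles_of_sorted_angles: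
  assumes \<gamma>: "0 < \<gamma>" "\<gamma> < 1" and \<eta>: "0 < \<eta>" "\<eta> \<le> 1"
    and S: "S1T S" and s: "is_enum s S" "range s \<subseteq> off_cut \<gamma> \<eta>"
  shows "angles_of (sorted_angles \<gamma> s) S"
proof -
  let ?x = "\<lambda>j. cut_angle \<gamma> (s j)"
  let ?p = "\<lambda>j. max 0 (?x j)" and ?n = "\<lambda>j. max 0 (- ?x j)"
  note cs = summable_cut_angle[OF \<gamma> \<eta> s(2) S1T_enum_summable[OF S s(1)]]
  have null: "?p \<longlonglongrightarrow> 0" "?n \<longlonglongrightarrow> 0"
    by (rule summable_LIMSEQ_zero, rule summable_comparison_test'[OF cs, of 0], simp)+
  have same: "same_mult_off 0 (sorted_angles \<gamma> s) ?x"
    unfolding sorted_angles_def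
    by (intro weave_same_mult_off same_mult_off_kth_largest kth_largest_nonneg null) auto
  have "summable (\<lambda>j. \<bar>sorted_angles \<gamma> s j\<bar>)"
    using same_mult_off_suminf(1)[OF same_mult_off_sym[OF same], of "\<lambda>x. x"] cs by simp
  moreover have "is_enum (\<lambda>j. cis (sorted_angles \<gamma> s j)) S"
    unfolding is_enum_def
  proof
    fix z
    have cx: "cis (?x j) = s j" for j using s(2) by (intro cis_cut_angle) (auto simp: off_cut_def)
    show "ecount {j. cis (sorted_angles \<gamma> s j) = z} = S z"
    \<comment> \<open>Sorting does not control the multiplicity of 0, so the point 1 is treated
      apart: there the stream of zeros supplies the infinite multiplicity.\<close>
    proof (cases "z = 1")
      case True
      have "{j. sorted_angles \<gamma> s j = 0} \<subseteq> {j. cis (sorted_angles \<gamma> s j) = z}" using True by auto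
      moreover have "infinite {j. sorted_angles \<gamma> s j = 0}"
        unfolding sorted_angles_def by (rule weave_zero_infinite)
      ultimately have "infinite {j. cis (sorted_angles \<gamma> s j) = z}" by (meson infinite_super)
      then show ?thesis using S True by (simp add: ecount_def S1T_def S1_def)
    next
      case False
      then have "ecount {j. cis (sorted_angles \<gamma> s j) = z} = ecount {j. cis (?x j) = z}"
        using same_mult_off_comp[OF same, of cis] by (simp add: same_mult_off_def)
      also have "\<dots> = S z" using s(1) by (simp add: cx is_enum_def)
      finally show ?thesis .
    qed
  qed
  ultimately show ?thesis by (simp add: angles_of_def)
qed

lemma l1_lift_off_cut:
  assumes \<gamma>: "0 < \<gamma>" "\<gamma> < 1" and \<eta>: "0 < \<eta>" "\<eta> \<le> 1"
    and S: "\<And>r. r \<in> D \<Longrightarrow> S1T (S r)" and cont: "rcont arcdist D S"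
    and off: "\<And>r. r \<in> D \<Longrightarrow> rsupp (S r) \<subseteq> off_cut \<gamma> \<eta>"
  shows "\<exists>y. l1_lift D S y"
proof -
  define s where "s = (\<lambda>r. SOME s. is_enum s (S r))"
  have s: "is_enum (s r) (S r)" if r: "r \<in> D" for r
    unfolding s_def using S1T_enum[OF S[OF r]] by (metis someI)
  have l1: "l1_continuous_on D (\<lambda>r. sorted_angles \<gamma> (s r))"
    unfolding l1_continuous_on_def
  proof (intro ballI allI impI)
    fix p and e :: real assume p: "p \<in> D" and e: "0 < e"
    define e' where "e' = e / (4*pi/\<eta>)"
    have "0 < e'" using e \<eta> by (simp add: e'_def)
    then obtain d where "d > 0" and d: "\<And>q. q \<in> D \<Longrightarrow> dist q p < d \<Longrightarrow> rdist arcdist (S q) (S p) < ennreal e'"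
      using cont p unfolding rcont_def by blast
    moreover have "l1dist (sorted_angles \<gamma> (s q)) (sorted_angles \<gamma> (s p)) < ennreal e"
      if q: "q \<in> D" "dist q p < d" for q
    proof -
      obtain u v where uv: "is_enum u (S q)" "is_enum v (S p)" "summable (\<lambda>j. arcdist (u j) (v j))"
        and less: "(\<Sum>j. arcdist (u j) (v j)) < e'"
        using rdist_less_enum[OF d[OF q] arcdist_nonneg] .
      \<comment> \<open>The enumerations fixed in advance need not be close to each other;
        \<open>u\<close> and \<open>v\<close> are, and they have the same sorted angles.\<close>
      have "l1dist (sorted_angles \<gamma> (s q)) (sorted_angles \<gamma> (s p)) = l1dist (sorted_angles \<gamma> u) (sorted_angles \<gamma> v)"
        using sorted_angles_unique[OF s[OF q(1)] uv(1)] sorted_angles_unique[OF s[OF p] uv(2)] by simp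
      also have "\<dots> \<le> ennreal (4*pi/\<eta> * (\<Sum>j. arcdist (u j) (v j)))"
        using off[OF q(1)] off[OF p] is_enum_range[OF uv(1)] is_enum_range[OF uv(2)]
        by (intro l1dist_sorted_angles \<gamma> \<eta> uv(3) S1T_enum_summable[OF S[OF q(1)] uv(1)]
            S1T_enum_summable[OF S[OF p] uv(2)]) auto
      also have "\<dots> < ennreal e"
      proof (rule ennreal_lessI[OF e])
        have "4*pi/\<eta> * (\<Sum>j. arcdist (u j) (v j)) < 4*pi/\<eta> * e'"
          using less \<eta> by (intro mult_strict_left_mono) auto
        also have "\<dots> = e" using \<eta> by (simp add: e'_def)
        finally show "4*pi/\<eta> * (\<Sum>j. arcdist (u j) (v j)) < e" .
      qed
      finally show ?thesis .
    qed
    ultimately show "\<exists>d>0. \<forall>q\<in>D. dist q p < d \<longrightarrow>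
        l1dist (sorted_angles \<gamma> (s q)) (sorted_angles \<gamma> (s p)) < ennreal e" by blast
  qed
  have "angles_of (sorted_angles \<gamma> (s r)) (S r)" if "r \<in> D" for r
    using off[OF that] is_enum_range[OF s[OF that]]
    by (intro angles_of_sorted_angles[OF \<gamma> \<eta> S[OF that] s[OF that]]) simp
  with l1 show ?thesis unfolding l1_lift_def by blast
qed

lemma locally_off_cut:
  assumes S: "\<And>r. r \<in> D \<Longrightarrow> S1T (S r)" and cont: "rcont arcdist D S" and p: "p \<in> D"
  obtains \<gamma> \<eta> d where "0 < \<gamma>" "\<gamma> < 1" "0 < \<eta>" "\<eta> \<le> 1" "0 < d"
    "\<And>r. r \<in> D \<Longrightarrow> dist r p < d \<Longrightarrow> rsupp (S r) \<subseteq> off_cut \<gamma> \<eta>"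
proof -
  obtain s where s: "is_enum s (S p)" "summable (\<lambda>j. \<bar>Arg (s j)\<bar>)" "\<And>j. cmod (s j) = 1"
    using S1T_enum[OF S[OF p]] by blast
  define J where "J = {j. 1/2 < \<bar>Arg (s j)\<bar>}"
  have "finite J"
    unfolding J_def using summable_LIMSEQ_zero[OF s(2)] by (rule finite_greater_of_null_nonneg) simp
  \<comment> \<open>A point \<open>s j\<close> lies on the cut only if
    \<open>cis \<gamma> = - cnj (s j)\<close>, so each of the finitely many far points excludes at
    most one \<gamma>.\<close>
  then have "infinite ({0<..<1} - (\<lambda>j. Arg (- cnj (s j))) ` J)"
    by (intro Diff_infinite_finite) auto
  then have "{0<..<1} - (\<lambda>j. Arg (- cnj (s j))) ` J \<noteq> {}" by (rule infinite_imp_nonempty)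
  then obtain \<gamma> where "\<gamma> \<in> {0<..<1} - (\<lambda>j. Arg (- cnj (s j))) ` J" by (auto simp only: ex_in_conv[symmetric])
  then have \<gamma>: "0 < \<gamma>" "\<gamma> < 1" "\<And>j. j \<in> J \<Longrightarrow> \<gamma> \<noteq> Arg (- cnj (s j))" by auto
  \<comment> \<open>The entry 2 bounds the points outside \<open>J\<close>, whose angles after
    rotation are at most 1/2 + \<gamma> < 3/2 in modulus.\<close>
  define M where "M = Max (insert 2 ((\<lambda>j. \<bar>Arg (s j * cis \<gamma>)\<bar>) ` J))"
  have finM: "finite (insert 2 ((\<lambda>j. \<bar>Arg (s j * cis \<gamma>)\<bar>) ` J))" using \<open>finite J\<close> by simp
  have "\<bar>Arg (s j * cis \<gamma>)\<bar> < pi" if "j \<in> J" for j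
  proof (rule ccontr)
    assume "\<not> \<bar>Arg (s j * cis \<gamma>)\<bar> < pi"
    then have "Arg (s j * cis \<gamma>) = pi" using Arg_bounded[of "s j * cis \<gamma>"] by auto
    then have "s j * cis \<gamma> = -1" using cis_Arg_unit[of "s j * cis \<gamma>"] s(3) by (simp add: norm_mult)
    then have "(cnj (s j) * s j) * cis \<gamma> = - cnj (s j)" by (simp add: mult.assoc)
    moreover have "cnj (s j) * s j = 1" using s(3)[of j] by (simp add: mult.commute complex_norm_square[symmetric])
    ultimately have "Arg (- cnj (s j)) = \<gamma>" using Arg_cis_small[OF \<gamma>(1,2)] by simp
    with \<gamma>(3)[OF that] show False by simp
  qed
  then have M: "2 \<le> M" "M < pi"
    unfolding M_def using finM pi_gt3 by (auto simp del: Max_insert)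
  have le_M: "\<bar>Arg (s j * cis \<gamma>)\<bar> \<le> M" for j
  proof (cases "j \<in> J")
    case True
    then show ?thesis unfolding M_def by (intro Max_ge[OF finM]) auto
  next
    case False
    then have "\<bar>Arg (s j)\<bar> \<le> 1/2" by (simp add: J_def)
    moreover have "Arg (cis (Arg (s j) + \<gamma>)) = Arg (s j) + \<gamma>"
      using calculation \<gamma> pi_gt3 by (intro Arg_cis) auto
    ultimately show ?thesis using M(1) \<gamma> s(3) by (simp add: cis_mult[symmetric] cis_Arg_unit)
  qed
  \<comment> \<open>Half of the gap between \<open>M\<close> and pi absorbs the displacement of the
    points when the parameter moves; the other half remains as the margin.\<close>
  define \<eta> where "\<eta> = (pi - M) / 2"
  have \<eta>: "0 < \<eta>" "\<eta> \<le> 1" using M pi_less_4 by (auto simp: \<eta>_def)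
  obtain d where "0 < d" and d: "\<And>q. q \<in> D \<Longrightarrow> dist q p < d \<Longrightarrow> rdist arcdist (S q) (S p) < ennreal \<eta>"
    using cont p \<eta>(1) unfolding rcont_def by blast
  show thesis
  proof (rule that[OF \<gamma>(1,2) \<eta> \<open>0 < d\<close>])
    fix q assume q: "q \<in> D" "dist q p < d"
    obtain u v where uv: "is_enum u (S q)" "is_enum v (S p)" "summable (\<lambda>j. arcdist (u j) (v j))"
      and less: "(\<Sum>j. arcdist (u j) (v j)) < \<eta>"
      using rdist_less_enum[OF d[OF q] arcdist_nonneg] .
    have "u j \<in> off_cut \<gamma> \<eta>" for j
    proof -
      have unit: "cmod (u j) = 1" "cmod (v j) = 1"
        using is_enum_S1T_cmod[OF S[OF q(1)] uv(1)] is_enum_S1T_cmod[OF S[OF p] uv(2)] by auto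
      let ?B = "Arg (v j * cis \<gamma>)" and ?\<xi> = "Arg (u j * cnj (v j))"
      have "v j \<in> range s" using is_enum_range[OF s(1)] is_enum_range[OF uv(2)] by blast
      then have B: "\<bar>?B\<bar> \<le> M" using le_M by auto
      have "sum (\<lambda>j. arcdist (u j) (v j)) {j} \<le> (\<Sum>j. arcdist (u j) (v j))"
        by (rule sum_le_suminf[OF uv(3)]) (auto simp: arcdist_nonneg)
      then have "\<bar>?\<xi>\<bar> < \<eta>" using less by (simp add: arcdist_def)
      then have bound: "\<bar>?B + ?\<xi>\<bar> < M + \<eta>" using B by linarith
      have "M + \<eta> = pi - \<eta>" unfolding \<eta>_def by (simp add: field_simps)
      with bound have lt: "\<bar>?B + ?\<xi>\<bar> < pi - \<eta>" by simp
      have "Arg (u j * cis \<gamma>) = Arg (cis (Arg (u j * cis \<gamma>)))"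
        using unit by (simp add: cis_Arg_unit norm_mult)
      also have "\<dots> = Arg (cis (?B + ?\<xi>))" using cis_Arg_diff[OF unit] by simp
      also have "\<dots> = ?B + ?\<xi>" using lt \<eta>(1) by (intro Arg_cis) auto
      finally show ?thesis using lt unit by (simp add: off_cut_def)
    qed
    then show "rsupp (S q) \<subseteq> off_cut \<gamma> \<eta>"
      unfolding is_enum_range[OF uv(1), symmetric] by auto
  qed
qed

section \<open>Global lifts by bisection\<close>

lemma rcont_subset: "rcont \<delta> D S \<Longrightarrow> D' \<subseteq> D \<Longrightarrow> rcont \<delta> D' S"
  unfolding rcont_def by (meson subsetD)

lemma l1_lift_extend:
  assumes ab: "a \<le> b" and S: "\<And>r. r \<in> {a..b} \<Longrightarrow> S1T (S r)" and cont: "rcont arcdist {a..b} S"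
    and x: "angles_of x (S a)"
  shows "\<exists>y. l1_lift {a..b} S y \<and> y a = x"
proof -
  \<comment> \<open>Allowing every initial value \<open>x\<close> makes \<open>P\<close> additive
    over adjacent intervals: the right piece starts from the final value of the left one.\<close>
  define P where "P = (\<lambda>c d. a \<le> c \<longrightarrow> c \<le> d \<longrightarrow> d \<le> b \<longrightarrow>
    (\<forall>x. angles_of x (S c) \<longrightarrow> (\<exists>y. l1_lift {c..d} S y \<and> y c = x)))"
  have "P a b"
  proof (rule Bolzano[OF ab])
    fix c m d assume 1: "P c m" and 2: "P m d" and le: "c \<le> m" "m \<le> d"
    show "P c d"
      unfolding P_def
    proof (intro impI allI)
      fix x assume r: "a \<le> c" "d \<le> b" and x: "angles_of x (S c)"
      obtain y where y: "l1_lift {c..m} S y" "y c = x" using 1 r le x unfolding P_def by auto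
      have "angles_of (y m) (S m)" using y(1) le by (auto simp: l1_lift_def)
      then obtain z where z: "l1_lift {m..d} S z" "z m = y m" using 2 r le unfolding P_def by auto
      show "\<exists>y. l1_lift {c..d} S y \<and> y c = x"
        using l1_lift_glue[OF y(1) z(1) z(2)[symmetric]] y(2) le by (intro exI conjI) (assumption, simp)
    qed
  next
    fix p assume "a \<le> p" "p \<le> b"
    then have p: "p \<in> {a..b}" by simp
    obtain \<gamma> \<eta> e where g: "0 < \<gamma>" "\<gamma> < 1" "0 < \<eta>" "\<eta> \<le> 1" and "0 < e"
      and off: "\<And>r. r \<in> {a..b} \<Longrightarrow> dist r p < e \<Longrightarrow> rsupp (S r) \<subseteq> off_cut \<gamma> \<eta>"
      using locally_off_cut[where S = S and D = "{a..b}" and p = p] S cont p by metis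
    have "P c d" if cd: "c \<le> p" "p \<le> d" "d - c < e" for c d
      unfolding P_def
    proof (intro impI allI)
      fix x assume r: "a \<le> c" "c \<le> d" "d \<le> b" and x: "angles_of x (S c)"
      have sub: "{c..d} \<subseteq> {a..b}" using r by auto
      have "dist q p < e" if "q \<in> {c..d}" for q using that cd by (auto simp: dist_real_def)
      then have "\<exists>y. l1_lift {c..d} S y"
        using sub by (intro l1_lift_off_cut[OF g] rcont_subset[OF cont sub] off S) auto
      then show "\<exists>y. l1_lift {c..d} S y \<and> y c = x"
        using l1_lift_initial[of "{c..d}" S _ c x] x r by auto
    qed
    with \<open>0 < e\<close> show "\<exists>e>0. \<forall>c d. c \<le> p \<and> p \<le> d \<and> d - c < e \<longrightarrow> P c d" by blast
  qed
  then show ?thesis using ab x by (simp add: P_def)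
qed

section \<open>From l1-lifts to lifts with branches\<close>

lemma angles_of_zero_infinite:
  assumes "S1T S" "angles_of x S"
  shows "infinite {j. x j = 0}"
proof
  assume fin: "finite {j. x j = 0}"
  have "x \<longlonglongrightarrow> 0"
    using assms(2) by (auto simp: angles_of_def intro: summable_LIMSEQ_zero summable_rabs_cancel)
  then have "finite {j. 1 < \<bar>x j\<bar>}" by (rule finite_greater_of_null) simp
  \<comment> \<open>The point 1 is listed infinitely often, always by a multiple of 2*pi. The
    nonzero multiples exceed 1 in modulus and occur finitely often, so 0 receives the infinite
    multiplicity that \<open>S1R\<close> demands.\<close>
  moreover have "{j. cis (x j) = 1} \<subseteq> {j. x j = 0} \<union> {j. 1 < \<bar>x j\<bar>}"
  proof
    fix j assume j: "j \<in> {j. cis (x j) = 1}"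
    then have "cis (x j) = cis 0" by simp
    then obtain n :: int where n: "x j = 2*pi*n" unfolding cis_eq_iff by auto
    show "j \<in> {j. x j = 0} \<union> {j. 1 < \<bar>x j\<bar>}"
    proof (cases "n = 0")
      case False
      then have "1 \<le> \<bar>real_of_int n\<bar>" by linarith
      then have "2*pi*1 \<le> 2*pi*\<bar>real_of_int n\<bar>" by (intro mult_left_mono) auto
      then have "2*pi \<le> \<bar>x j\<bar>" using n by (simp add: abs_mult)
      then show ?thesis using pi_gt3 by auto
    qed (use n in simp)
  qed
  ultimately have "finite {j. cis (x j) = 1}" using fin by (meson finite_UnI finite_subset)
  moreover have "ecount {j. cis (x j) = 1} = \<infinity>"
    using assms by (simp add: angles_of_def is_enum_def S1T_def S1_def)
  ultimately show False by (simp add: ecount_def)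
qed

definition listed :: "(nat \<Rightarrow> 'a) \<Rightarrow> 'a rigged" where
  "listed x = (\<lambda>v. ecount {j. x j = v})"

lemma is_enum_listed: "is_enum x (listed x)"
  by (simp add: is_enum_def listed_def)

lemma S1R_listed:
  assumes summ: "summable (\<lambda>j. \<bar>x j\<bar>)" and inf: "infinite {j. x j = 0}"
  shows "S1R (listed x)"
proof -
  have supp: "rsupp (listed x) = range x" by (rule is_enum_range[OF is_enum_listed, symmetric])
  have null: "x \<longlonglongrightarrow> 0" using summ by (auto intro: summable_LIMSEQ_zero summable_rabs_cancel)
  have isol: "\<exists>e>0. \<forall>v\<in>range x. v \<noteq> y \<longrightarrow> e \<le> dist v y" if "y \<noteq> 0" for y
  proof -
    \<comment> \<open>Terms of modulus at most \<open>\<bar>y\<bar>/2\<close> stay at least that far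
      from \<open>y\<close>; the others take finitely many values.\<close>
    define V where "V = insert 0 (x ` {j. \<bar>y\<bar>/2 < \<bar>x j\<bar>})"
    have "finite V" unfolding V_def using finite_greater_of_null[OF null, of "\<bar>y\<bar>/2"] that by simp
    then obtain e where e: "e > 0" "\<And>v. v \<in> V \<Longrightarrow> v \<noteq> y \<Longrightarrow> e \<le> dist y v"
      using finite_set_avoid by metis
    have "min e (\<bar>y\<bar>/2) \<le> dist (x j) y" if "x j \<noteq> y" for j
    proof (cases "x j \<in> V")
      case True
      then show ?thesis using e(2)[OF True that] by (simp add: dist_commute)
    next
      case False
      then have "\<bar>x j\<bar> \<le> \<bar>y\<bar>/2" by (auto simp: V_def)
      then show ?thesis unfolding dist_real_def by linarith
    qed
    then show ?thesis using e(1) \<open>y \<noteq> 0\<close> by (intro exI[of _ "min e (\<bar>y\<bar>/2)"]) auto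
  qed
  have "rdist dist (listed x) (rpoint 0) \<le> (\<Sum>j. ennreal \<bar>x j\<bar>)"
    by (rule order_trans[OF rdist_le_suminf[OF is_enum_listed is_enum_rpoint_iff[THEN iffD2, OF refl]]]) simp
  also have "\<dots> = ennreal (\<Sum>j. \<bar>x j\<bar>)" using summ by (intro suminf_ennreal2) auto
  also have "\<dots> < top" by simp
  finally have "rdist dist (listed x) (rpoint 0) < top" .
  moreover have "\<not> (\<forall>e>0. \<exists>v\<in>range x. v \<noteq> y \<and> dist v y < e)" if "y \<noteq> 0" for y
    using isol[OF that] by (meson not_less)
  moreover have "listed x 0 = \<infinity>" using inf by (simp add: listed_def ecount_def)
  ultimately show ?thesis by (simp add: S1R_def S1_def supp)
qed

text \<open>The sequences \<open>y q\<close> and \<open>y p\<close> are themselves competing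
  enumerations, so \<open>l1dist\<close> bounds \<open>rdist\<close>. It also bounds every
  coordinate difference, which makes the branches continuous.\<close>

lemma l1_lift_imp_branches:
  assumes S: "\<And>r. r \<in> {a..b} \<Longrightarrow> S1T (S r)" and y: "l1_lift {a..b} S y"
  shows "is_lift a b S (\<lambda>r. listed (y r))" and "is_branches a b (\<lambda>r. listed (y r)) (\<lambda>j r. y r j)"
proof -
  have ang: "angles_of (y r) (S r)" if "r \<in> {a..b}" for r using y that by (simp add: l1_lift_def)
  have cont: "\<exists>d>0. \<forall>q\<in>{a..b}. dist q p < d \<longrightarrow> l1dist (y q) (y p) < ennreal e" if "p \<in> {a..b}" "0 < e" for p e
    using y that by (simp add: l1_lift_def l1_continuous_on_def)
  have "S1R (listed (y r))" if "r \<in> {a..b}" for r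
    using ang[OF that] angles_of_zero_infinite[OF S ang, OF that that] by (intro S1R_listed) (simp_all add: angles_of_def)
  moreover have "rcont dist {a..b} (\<lambda>r. listed (y r))"
    unfolding rcont_def
  proof (intro ballI allI impI)
    fix p e :: real assume "p \<in> {a..b}" "0 < e"
    moreover have "rdist dist (listed (y q)) (listed (y p)) \<le> l1dist (y q) (y p)" for q
      using rdist_le_suminf[OF is_enum_listed is_enum_listed, of dist "y q" "y p"]
      by (simp add: l1dist_def dist_real_def)
    ultimately show "\<exists>d>0. \<forall>q\<in>{a..b}. dist q p < d \<longrightarrow> rdist dist (listed (y q)) (listed (y p)) < ennreal e"
      using cont by (meson le_less_trans)
  qed
  moreover have "pmap (listed (y r)) = S r" if "r \<in> {a..b}" for r
  proof
    fix z
    have "pmap (listed (y r)) z = ecount {j. y r j \<in> {\<theta>. cis \<theta> = z}}"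
      unfolding pmap_def listed_def by (rule SUP_sum_ecount)
    also have "\<dots> = S r z" using ang[OF that] by (simp add: angles_of_def is_enum_def)
    finally show "pmap (listed (y r)) z = S r z" .
  qed
  ultimately show "is_lift a b S (\<lambda>r. listed (y r))" by (simp add: is_lift_def)
  have "continuous_on {a..b} (\<lambda>r. y r j)" for j
    unfolding continuous_on_iff
  proof (intro ballI allI impI)
    fix p e :: real assume p: "p \<in> {a..b}" "0 < e"
    have "dist (y q j) (y p j) < e" if "l1dist (y q) (y p) < ennreal e" for q
    proof -
      have "ennreal \<bar>y q j - y p j\<bar> = (\<Sum>i\<in>{j}. ennreal \<bar>y q i - y p i\<bar>)" by simp
      also have "\<dots> \<le> l1dist (y q) (y p)"
        unfolding l1dist_def by (rule sum_le_suminf) (auto intro: summableI)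
      finally have "ennreal \<bar>y q j - y p j\<bar> < ennreal e" using that by (rule le_less_trans)
      then show ?thesis by (simp add: ennreal_less_iff dist_real_def)
    qed
    with cont[OF p] show "\<exists>d>0. \<forall>q\<in>{a..b}. dist q p < d \<longrightarrow> dist (y q j) (y p j) < e" by meson
  qed
  then show "is_branches a b (\<lambda>r. listed (y r)) (\<lambda>j r. y r j)"
    by (simp add: is_branches_def listed_def)
qed

section \<open>Evaluation of \<open>mu\<close> and the homotopy invariance\<close>

lemma lift_branches_exist:
  assumes ab: "a \<le> b" and S: "\<And>r. r \<in> {a..b} \<Longrightarrow> S1T (S r)" and cont: "rcont arcdist {a..b} S"
  obtains L th where "is_lift a b S L" "is_branches a b L th"
proof -
  have a: "a \<in> {a..b}" using ab by simp
  obtain s where s: "is_enum s (S a)" "summable (\<lambda>j. \<bar>Arg (s j)\<bar>)" "\<And>j. cmod (s j) = 1"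
    using S1T_enum[OF S[OF a]] by blast
  then have "angles_of (\<lambda>j. Arg (s j)) (S a)" by (simp add: angles_of_def cis_Arg_unit)
  then obtain y where y: "l1_lift {a..b} S y" using l1_lift_extend[OF ab S cont] by blast
  show thesis using that l1_lift_imp_branches[of a b S y] S y by blast
qed

text \<open>Existence of a lift with branches matters here: without one, the choice in \<open>mu\<close> is arbitrary.\<close>

lemma mu_eqI:
  assumes ab: "a \<le> b" and S: "\<And>r. r \<in> {a..b} \<Longrightarrow> S1T (S r)" and cont: "rcont arcdist {a..b} S"
    and eq: "\<And>L th. is_lift a b S L \<Longrightarrow> is_branches a b L th \<Longrightarrow> (\<Sum>j. bracket \<theta> (th j a) (th j b)) = c"
  shows "mu \<theta> a b S = c"
proof -
  obtain L th where "is_lift a b S L" "is_branches a b L th" using lift_branches_exist[OF ab S cont] .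
  then have "\<exists>v L th. is_lift a b S L \<and> is_branches a b L th \<and> v = (\<Sum>j. bracket \<theta> (th j a) (th j b))"
    by blast
  then have "\<exists>L th. is_lift a b S L \<and> is_branches a b L th \<and> mu \<theta> a b S = (\<Sum>j. bracket \<theta> (th j a) (th j b))"
    unfolding mu_def by (rule someI_ex)
  then show ?thesis using eq by force
qed

theorem mainTheorem8:
  fixes F :: "real \<times> real \<Rightarrow> complex rigged" and F1 :: "complex rigged" and a b :: real
  assumes "a < b"
    and "S1T F1"
    and "\<forall>p\<in>{a..b} \<times> {0..1}. S1T (F p)"
    and "rcont arcdist ({a..b} \<times> {0..1}) F"
    and "\<forall>t\<in>{0..1}. F (a, t) = rpoint 1"
    and "\<forall>t\<in>{0..1}. F (b, t) = F1"
  shows "\<forall>\<theta>\<in>{0<..<2*pi}. mu \<theta> a b (\<lambda>r. F (r, 0)) = mu \<theta> a b (\<lambda>r. F (r, 1))"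
proof
  fix \<theta> :: real assume \<theta>: "\<theta> \<in> {0<..<2*pi}"
  have ab: "a \<le> b" using assms(1) by simp
  have S: "S1T (F (r, t))" if "t \<in> {0..1}" "r \<in> {a..b}" for r t using assms(3) that by blast
  have cont: "rcont arcdist {a..b} (\<lambda>r. F (r, t))" if "t \<in> {0..1}" for t
    unfolding rcont_def
  proof (intro ballI allI impI)
    fix p e :: real assume p: "p \<in> {a..b}" "0 < e"
    then have "(p, t) \<in> {a..b} \<times> {0..1}" using that by simp
    then obtain d where "d > 0" "\<And>q. q \<in> {a..b} \<times> {0..1} \<Longrightarrow> dist q (p, t) < d
        \<Longrightarrow> rdist arcdist (F q) (F (p, t)) < ennreal e"
      using assms(4) p(2) unfolding rcont_def by meson
    moreover have "dist (q, t) (p, t) = dist q p" for q by (simp add: dist_prod_def)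
    ultimately show "\<exists>d>0. \<forall>q\<in>{a..b}. dist q p < d \<longrightarrow> rdist arcdist (F (q, t)) (F (p, t)) < ennreal e"
      using that by (intro exI[of _ d]) auto
  qed
  have ends: "rprod (F (a, t)) = rprod (F (a, 0))" "rprod (F (b, t)) = rprod (F (b, 0))" if "t \<in> {0..1}" for t
    using assms(5,6) that by simp_all
  have "continuous_on ({a..b} \<times> {0..1}) (\<lambda>p. rprod (F p))"
    using assms(3) by (intro rprod_continuous[OF assms(4)]) blast
  then have "\<exists>c. \<forall>t\<in>{0..1}. \<forall>f. continuous_on {a..b} f
      \<longrightarrow> (\<forall>r\<in>{a..b}. cis (f r) = rprod (F (r, t))) \<longrightarrow> f b - f a = c"
    by (rule homotopy_lift_increment[OF ab]) (rule ends | simp add: rprod_def)+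
  then obtain c where "\<forall>t\<in>{0..1}. \<forall>f. continuous_on {a..b} f
      \<longrightarrow> (\<forall>r\<in>{a..b}. cis (f r) = rprod (F (r, t))) \<longrightarrow> f b - f a = c" ..
  note c = this[rule_format]
  obtain s where s: "is_enum s (rpoint 1 :: complex rigged)"
    using is_enum_rpoint_iff[THEN iffD2, OF refl] ..
  obtain u where u: "is_enum u F1" using S1T_enum[OF assms(2)] by blast
  \<comment> \<open>The value is explicit and free of \<open>t\<close>: one \<open>c\<close> serves
    all paths, and \<open>s\<close> and \<open>u\<close> enumerate their common end points.\<close>
  have "mu \<theta> a b (\<lambda>r. F (r, t)) =
      c / (2*pi) + ((\<Sum>j. jump_defect \<theta> (u j)) - (\<Sum>j. jump_defect \<theta> (s j)))" if t: "t \<in> {0..1}" for t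
  proof (rule mu_eqI[OF ab S[OF t] cont[OF t]])
    fix L th assume L: "is_lift a b (\<lambda>r. F (r, t)) L" and th: "is_branches a b L th"
    have "(\<Sum>j. th j b) - (\<Sum>j. th j a) = c"
      using S[OF t] by (intro c[OF t] branches_sum_continuous[OF L th] cis_branches_sum[OF _ L th]) auto
    then show "(\<Sum>j. bracket \<theta> (th j a) (th j b)) =
        c / (2*pi) + ((\<Sum>j. jump_defect \<theta> (u j)) - (\<Sum>j. jump_defect \<theta> (s j)))"
      using bracket_sum[OF \<theta> L th ab, of s u] s u assms(5,6) t by simp
  qed
  then show "mu \<theta> a b (\<lambda>r. F (r, 0)) = mu \<theta> a b (\<lambda>r. F (r, 1))" by simp
qed

end
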